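(* Let $\mathcal A$ be an Apollonian disk packing and let $\mathcal B\in\mathcal A$ be a disk of curvature $B$. Let $\mathbf u=\begin{bmatrix} a\\ b\end{bmatrix}$ and $\mathbf v=\begin{bmatrix} c\\ d\end{bmatrix}$ be tangency spinors (each with an arbitrary choice of sign) oriented from $\mathcal B$ towards two mutually tangent disks in the corona of $\mathcal B$, and put $M=[\mathbf u|\mathbf v]=\begin{bmatrix} a & c\\ b& d\end{bmatrix}$. Then the area of the entire corona of $\mathcal B$ is $$A(M)=\frac{\pi}{2}\sum_{\mathbf f\in\mathbb Z^2_{\mathrm E}}\frac{1}{\big(\|M\mathbf f\|^2-B\big)^{2}}=\frac{\pi}{2}\sum_{\substack{m,n\in\mathbb Z\\ \gcd(m,n)=1}}\frac{1}{\big((am+cn)^2+(bm+dn)^2-B\big)^2}.$$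
   Context: Disks. A (generalized) disk in the plane $\mathbb R^2\cong\mathbb C$ is one of: a closed round disk of radius $r>0$ (curvature $1/r$); the closure of the exterior of a circle of radius $r>0$ (its radius is taken to be $-r$ and its curvature $-1/r$; its center is the center of the circle); a closed half-plane (curvature $0$). Two disks are tangent if their interiors are disjoint and their boundary circles/lines are tangent (two complementary-side parallel half-planes with disjoint interiors count as tangent at infinity). Apollonian disk packing. The collection $\mathcal A$ of disks obtained from three mutually tangent disks by repeatedly adjoining, for every three mutually tangent disks already present, both disks that are tangent to all three. The corona of a disk $\mathcal B\in\mathcal A$ is the set of all disks of $\mathcal A$ tangent to $\mathcal B$. Tangency spinor. For an ordered pair of tangent disks of curvatures $A$ and $B$, the tangency spinor is the complex number $u$, defined up to sign, with $u^2=AB\,z$, where $z\in\mathbb C$ is the vector from the center of the first disk to the center of the second. It satisfies $|u|^2=A+B$. Equivalently, $u^2=(A+B)e$, where $e\in\mathbb C$ is the unit normal at the point of tangency pointing out of the first disk (into the second); this form is used when one of the disks is a half-plane (and $u=0$ if both are half-planes). The spinor $u=m+ni$ is identified with the vector $\begin{bmatrix} m\\ n\end{bmatrix}\in\mathbb R^2$. Area. The area attributed to a disk of curvature $\kappa$ is $\pi/\kappa^2$ (also when $\kappa<0$; when $\kappa=0$ it is $+\infty$). The area of a corona is the sum of the areas of the disks in it, as an element of $[0,+\infty]$, with the convention $1/0=+\infty$ in sums. $\mathbb Z^2_{\mathrm E}=\left\{\begin{bmatrix} m\\ n\end{bmatrix}\in\mathbb Z^2 : \gcd(m,n)=1\right\}$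 (negative entries allowed; it includes $(\pm1,0)$ and $(0,\pm1)$), and $\|\cdot\|$ is the Euclidean norm on $\mathbb R^2$. *)

theory Defs
  imports "HOL-Analysis.Analysis"
begin

text \<open>In \<open>HalfPlane n t\<close> the vector \<open>n\<close> is the unit normal pointing out of the half-plane.\<close>

datatype gdisk =
    RoundDisk complex real
  | ExteriorDisk complex real
  | HalfPlane complex real

fun is_disk :: "gdisk \<Rightarrow> bool" where
  "is_disk (RoundDisk c r) \<longleftrightarrow> r > 0"
| "is_disk (ExteriorDisk c r) \<longleftrightarrow> r > 0"
| "is_disk (HalfPlane n t) \<longleftrightarrow> norm n = 1"

fun disk_set :: "gdisk \<Rightarrow> complex set" where
  "disk_set (RoundDisk c r) = cball c r"
| "disk_set (ExteriorDisk c r) = closure (- cball c r)"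
| "disk_set (HalfPlane n t) = {z. n \<bullet> z \<le> t}"

fun curvature :: "gdisk \<Rightarrow> real" where
  "curvature (RoundDisk c r) = 1 / r"
| "curvature (ExteriorDisk c r) = - 1 / r"
| "curvature (HalfPlane n t) = 0"

fun is_half_plane :: "gdisk \<Rightarrow> bool" where
  "is_half_plane (HalfPlane n t) \<longleftrightarrow> True"
| "is_half_plane _ \<longleftrightarrow> False"

fun center :: "gdisk \<Rightarrow> complex" where
  "center (RoundDisk c r) = c"
| "center (ExteriorDisk c r) = c"
| "center (HalfPlane n t) = undefined"

text \<open>The unit normal at a boundary point \<open>p\<close>, pointing out of the disk.\<close>

fun outward_normal :: "gdisk \<Rightarrow> complex \<Rightarrow> complex" where
  "outward_normal (RoundDisk c r) p = (p - c) / of_real r"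
| "outward_normal (ExteriorDisk c r) p = (c - p) / of_real r"
| "outward_normal (HalfPlane n t) p = n"

text \<open>Two circles, or a circle and a line, are tangent when they meet in exactly one point.
  Half-planes with disjoint interiors automatically have parallel boundaries; they are tangent
  (at infinity) when these are distinct lines.\<close>

definition tangent :: "gdisk \<Rightarrow> gdisk \<Rightarrow> bool" where
  "tangent D E \<longleftrightarrow> is_disk D \<and> is_disk E \<and>
     interior (disk_set D) \<inter> interior (disk_set E) = {} \<and>
     (if is_half_plane D \<and> is_half_plane E
      then frontier (disk_set D) \<inter> frontier (disk_set E) = {}
      else \<exists>p. frontier (disk_set D) \<inter> frontier (disk_set E) = {p})"

definition mutually_tangent :: "gdisk \<Rightarrow> gdisk \<Rightarrow> gdisk \<Rightarrow> bool" where
  "mutually_tangent D E F \<longleftrightarrow> tangent D E \<and> tangent D F \<and> tangent E F"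

inductive_set generated_packing :: "gdisk \<Rightarrow> gdisk \<Rightarrow> gdisk \<Rightarrow> gdisk set"
  for D1 D2 D3 where
  first: "D1 \<in> generated_packing D1 D2 D3"
| second: "D2 \<in> generated_packing D1 D2 D3"
| third: "D3 \<in> generated_packing D1 D2 D3"
| adjoin: "\<lbrakk>E \<in> generated_packing D1 D2 D3; F \<in> generated_packing D1 D2 D3;
    G \<in> generated_packing D1 D2 D3; mutually_tangent E F G;
    tangent X E; tangent X F; tangent X G\<rbrakk> \<Longrightarrow> X \<in> generated_packing D1 D2 D3"

definition apollonian_packing :: "gdisk set \<Rightarrow> bool" where
  "apollonian_packing \<A> \<longleftrightarrow>
     (\<exists>D1 D2 D3. mutually_tangent D1 D2 D3 \<and> \<A> = generated_packing D1 D2 D3)"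

definition corona :: "gdisk set \<Rightarrow> gdisk \<Rightarrow> gdisk set" where
  "corona \<A> D = {E \<in> \<A>. tangent D E}"

text \<open>The spinor is only defined up to sign, hence a relation.\<close>

definition tangency_spinor :: "gdisk \<Rightarrow> gdisk \<Rightarrow> complex \<Rightarrow> bool" where
  "tangency_spinor D E u \<longleftrightarrow> tangent D E \<and>
     (if is_half_plane D \<and> is_half_plane E then u = 0
      else if is_half_plane D \<or> is_half_plane E then
        \<exists>p \<in> frontier (disk_set D) \<inter> frontier (disk_set E).
          u\<^sup>2 = of_real (curvature D + curvature E) * outward_normal D p
      else u\<^sup>2 = of_real (curvature D * curvature E) * (center E - center D))"

text \<open>Division in \<^typ>\<open>ennreal\<close> satisfies \<open>x / 0 = \<infinity>\<close> for \<open>x \<noteq> 0\<close>, so half-planes get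
  infinite area.\<close>

definition disk_area :: "gdisk \<Rightarrow> ennreal" where
  "disk_area D = ennreal pi / ennreal ((curvature D)\<^sup>2)"

definition corona_area :: "gdisk set \<Rightarrow> gdisk \<Rightarrow> ennreal" where
  "corona_area \<A> D = (\<Sum>\<^sub>\<infinity>E\<in>corona \<A> D. disk_area E)"

definition ZE :: "(real^2) set" where
  "ZE = {vector [of_int m, of_int n] | m n :: int. gcd m n = 1}"

end

theory Submission imports Defs begin

text \<open>
  A disk \<open>\<kappa> |z|\<^sup>2 - 2 w \<bullet> z + \<kappa>' \<le> 0\<close>, normalised by \<open>|w|\<^sup>2 - \<kappa> \<kappa>' = 1\<close>, is a unit vector
  \<open>(\<kappa>, \<kappa>', w)\<close> of a Lorentzian space. Two disks are tangent iff their product is \<open>-1\<close> and their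
  sum, a null vector, is future directed. Given mutually tangent \<open>D, E, F\<close> and a fourth disk \<open>G\<close>
  tangent to all three, the vectors
  \<open>X(m,n) = m\<^sup>2 (D + E) + n\<^sup>2 (D + F) + m n (G - D - E - F) - D\<close> with coprime \<open>m, n\<close> are tangent to \<open>D\<close>, and
  \<open>\<langle>X(f), X(g)\<rangle> = 1 - 2 det(f,g)\<^sup>2\<close>, as for Ford circles. The Euclidean algorithm produces all of them by
  adjoining disks. Conversely, a packing is contained in the orbit of a Descartes configuration under
  replacing one member at a time. As long as \<open>D\<close> is not replaced, only the vectors \<open>X(m,n)\<close> arise;
  after that, in a reduced sequence of replacements, each new vector has a product with \<open>D\<close>
  below \<open>-1\<close> that is minimal in its configuration, so no further tangent disk appears. Finally \<open>X(m,n)\<close> has curvature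
  \<open>\<parallel>m u + n v\<parallel>\<^sup>2 - B\<close>: the mixed term is, up to sign, \<open>2 u \<bullet> v\<close> by Descartes' circle theorem. Each disk of
  the corona occurs for exactly two coprime pairs, \<open>\<plusminus>(m,n)\<close>.
\<close>

section \<open>The quadratic form on disk vectors\<close>

type_synonym disk_vec = "real \<times> real \<times> complex"

text \<open>The polarisation of \<open>|w|^2 - k k'\<close>, a form of signature (3,1) on triples
  \<open>(k, k', w)\<close>.\<close>

definition disk_form :: "disk_vec \<Rightarrow> disk_vec \<Rightarrow> real" where
  "disk_form x y = snd (snd x) \<bullet> snd (snd y) - (fst x * fst (snd y) + fst (snd x) * fst y) / 2"

text \<open>A nonzero null vector is future directed iff \<open>tau\<close> is positive on it.\<close>

definition tau :: "disk_vec \<Rightarrow> real" where "tau x = fst x + fst (snd x)"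

lemma disk_form_add_left: "disk_form (x + y) z = disk_form x z + disk_form y z"
  and disk_form_diff_left: "disk_form (x - y) z = disk_form x z - disk_form y z"
  and disk_form_scale_left: "disk_form (r *\<^sub>R x) z = r * disk_form x z"
  and disk_form_zero_left: "disk_form 0 z = 0"
  and disk_form_minus_left: "disk_form (- x) z = - disk_form x z"
  by (simp_all add: disk_form_def inner_add_left inner_diff_left algebra_simps add_divide_distrib diff_divide_distrib)

lemma disk_form_commute: "disk_form x y = disk_form y x"
  by (simp add: disk_form_def inner_commute algebra_simps)

lemma disk_form_add_right: "disk_form z (x + y) = disk_form z x + disk_form z y"
  and disk_form_diff_right: "disk_form z (x - y) = disk_form z x - disk_form z y"
  and disk_form_scale_right: "disk_form z (r *\<^sub>R x) = r * disk_form z x"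
  and disk_form_zero_right: "disk_form z 0 = 0"
  and disk_form_minus_right: "disk_form z (- x) = - disk_form z x"
  by (simp_all add: disk_form_commute[of z _] disk_form_add_left disk_form_diff_left
      disk_form_scale_left disk_form_zero_left disk_form_minus_left)

lemmas disk_form_simps =
  disk_form_add_left disk_form_diff_left disk_form_scale_left disk_form_zero_left disk_form_minus_left
  disk_form_add_right disk_form_diff_right disk_form_scale_right disk_form_zero_right disk_form_minus_right

lemma disk_form_sum_left: "disk_form (sum f A) z = (\<Sum>x\<in>A. disk_form (f x) z)"
  by (induction A rule: infinite_finite_induct) (simp_all add: disk_form_simps)

lemma null_signs:
  assumes "disk_form x x = 0"
  shows "fst x * fst (snd x) = (norm (snd (snd x)))\<^sup>2"
    and "tau x \<le> 0 \<Longrightarrow> fst x \<le> 0 \<and> fst (snd x) \<le> 0"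
    and "tau x \<ge> 0 \<Longrightarrow> fst x \<ge> 0 \<and> fst (snd x) \<ge> 0"
proof -
  show *: "fst x * fst (snd x) = (norm (snd (snd x)))\<^sup>2"
    using assms by (simp add: disk_form_def power2_norm_eq_inner algebra_simps)
  then have "fst x * fst (snd x) \<ge> 0" by simp
  then show "tau x \<le> 0 \<Longrightarrow> fst x \<le> 0 \<and> fst (snd x) \<le> 0"
    and "tau x \<ge> 0 \<Longrightarrow> fst x \<ge> 0 \<and> fst (snd x) \<ge> 0"
    by (auto simp: tau_def zero_le_mult_iff)
qed

text \<open>A reversed Cauchy-Schwarz inequality on the light cone: if \<open>y\<close> were not
  future directed, the cross terms would outweigh the inner product of the complex parts and the
  form would be nonnegative.\<close>

lemma null_forward:
  assumes "disk_form x x = 0" "disk_form y y = 0" "disk_form x y < 0" "tau x > 0"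
  shows "tau y > 0"
proof (rule ccontr)
  assume "\<not> tau y > 0"
  then have y: "fst y \<le> 0" "fst (snd y) \<le> 0" using null_signs(2)[OF assms(2)] by auto
  have x: "fst x \<ge> 0" "fst (snd x) \<ge> 0" using null_signs(3)[OF assms(1)] assms(4) by auto
  define p where "p = - (fst x * fst (snd y))"
  define q where "q = - (fst (snd x) * fst y)"
  have pq: "p \<ge> 0" "q \<ge> 0" unfolding p_def q_def using x y by (simp_all add: mult_nonneg_nonpos)
  define N where "N = norm (snd (snd x)) * norm (snd (snd y))"
  have "p * q = N\<^sup>2"
    unfolding p_def q_def N_def power_mult_distrib null_signs(1)[OF assms(1), symmetric]
      null_signs(1)[OF assms(2), symmetric] by (simp add: algebra_simps)
  then have "(2 * N)\<^sup>2 \<le> (p + q)\<^sup>2"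
    using sum_squares_ge_zero[of "p - q" 0] by (simp add: power2_eq_square algebra_simps)
  then have "2 * N \<le> p + q" by (rule power2_le_imp_le) (use pq in simp)
  moreover have "- N \<le> snd (snd x) \<bullet> snd (snd y)"
    unfolding N_def using Cauchy_Schwarz_ineq2[of "snd (snd x)" "snd (snd y)"] by linarith
  ultimately show False using assms(3) by (simp add: disk_form_def p_def q_def)
qed

text \<open>Completing the square: for \<open>k \<noteq> 0\<close>, \<open>k^2\<close> times the
  self-product of \<open>x\<close> is \<open>|k z - a w|^2\<close>, whose vanishing forces
  proportionality. If \<open>k = 0\<close> then \<open>w = 0\<close>, and orthogonality gives
  \<open>a = 0\<close>.\<close>

lemma orthogonal_to_null:
  assumes l: "disk_form l l = 0" "l \<noteq> 0" and "disk_form l x = 0"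
  shows "disk_form x x \<ge> 0" and "disk_form x x = 0 \<Longrightarrow> \<exists>t. x = t *\<^sub>R l"
proof -
  obtain k k' w where l_eq: "l = (k, k', w)" by (cases l) auto
  obtain a a' z where x_eq: "x = (a, a', z)" by (cases x) auto
  have kk: "k * k' = w \<bullet> w" using l by (simp add: disk_form_def l_eq algebra_simps)
  have wz: "2 * (w \<bullet> z) = k * a' + k' * a" using assms(3) by (simp add: disk_form_def l_eq x_eq)
  have xx: "disk_form x x = z \<bullet> z - a * a'" by (simp add: disk_form_def x_eq)
  have "disk_form x x \<ge> 0 \<and> (disk_form x x = 0 \<longrightarrow> (\<exists>t. x = t *\<^sub>R l))"
  proof (cases "k = 0")
    case True
    then have w: "w = 0" using kk by simp
    then have "k' \<noteq> 0" using l(2) l_eq True by (simp add: zero_prod_def)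
    then have a: "a = 0" using wz w True by simp
    have "x = (a' / k') *\<^sub>R l" if "disk_form x x = 0"
      using that[unfolded xx] \<open>k' \<noteq> 0\<close> by (simp add: a x_eq l_eq True w)
    then show ?thesis by (auto simp: xx a)
  next
    case False
    have "(k *\<^sub>R z - a *\<^sub>R w) \<bullet> (k *\<^sub>R z - a *\<^sub>R w) = k * k * (z \<bullet> z) - a * k * (2 * (w \<bullet> z)) + a * a * (w \<bullet> w)"
      by (simp add: inner_diff_left inner_diff_right inner_commute algebra_simps)
    also have "\<dots> = k * k * (z \<bullet> z - a * a')"
      unfolding wz kk[symmetric] by (simp add: algebra_simps)
    finally have eq: "(k *\<^sub>R z - a *\<^sub>R w) \<bullet> (k *\<^sub>R z - a *\<^sub>R w) = k * k * disk_form x x" by (simp add: xx)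
    have kpos: "k * k > 0" using False by (simp add: zero_less_mult_iff) linarith
    have "k * k * disk_form x x \<ge> 0" unfolding eq[symmetric] by simp
    then have ge: "disk_form x x \<ge> 0" using kpos by (simp add: zero_le_mult_iff)
    have "x = (a / k) *\<^sub>R l" if "disk_form x x = 0"
    proof -
      have "k *\<^sub>R z = a *\<^sub>R w" using eq that by simp
      then have "(1 / k) *\<^sub>R (k *\<^sub>R z) = (1 / k) *\<^sub>R (a *\<^sub>R w)" by (rule arg_cong)
      then have z: "z = (a / k) *\<^sub>R w" using False by simp
      have "k * a' = 2 * (a / k) * (k * k') - k' * a"
        using wz unfolding kk z by simp
      then have "a' = (a / k) * k'" using False by (simp add: field_simps)
      then show ?thesis using z False by (simp add: x_eq l_eq)
    qed
    then show ?thesis using ge by blast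
  qed
  then show "disk_form x x \<ge> 0" and "disk_form x x = 0 \<Longrightarrow> \<exists>t. x = t *\<^sub>R l" by blast+
qed

section \<open>Tangent vectors and Descartes quadruples\<close>

definition vtangent :: "disk_vec \<Rightarrow> disk_vec \<Rightarrow> bool" where
  "vtangent x y \<longleftrightarrow> disk_form x x = 1 \<and> disk_form y y = 1 \<and> disk_form x y = - 1 \<and> tau (x + y) > 0"

definition quad :: "disk_vec \<Rightarrow> disk_vec \<Rightarrow> disk_vec \<Rightarrow> disk_vec \<Rightarrow> bool" where
  "quad D E F G \<longleftrightarrow> vtangent D E \<and> vtangent D F \<and> vtangent D G \<and> vtangent E F \<and> vtangent E G \<and> vtangent F G"

lemma vtangent_commute: "vtangent x y \<longleftrightarrow> vtangent y x"
  unfolding vtangent_def disk_form_commute[of y x] add.commute[of y x] by blast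

text \<open>The null vectors \<open>x + y\<close> and \<open>x + z\<close> have product -2, so
  \<open>null_forward\<close> carries the future direction from one to the other.\<close>

lemma vtangent_transfer:
  assumes "vtangent x y" "disk_form z z = 1" "disk_form x z = - 1" "disk_form y z = -1"
  shows "vtangent x z"
proof -
  have "tau (x + z) > 0"
    by (rule null_forward[of "x + y"])
      (use assms disk_form_commute[of z x] disk_form_commute[of y x] in \<open>auto simp: vtangent_def disk_form_simps\<close>)
  then show ?thesis using assms by (simp add: vtangent_def)
qed

lemma quadI:
  assumes "vtangent D E" "disk_form F F = 1" "disk_form G G = 1" "disk_form D F = - 1" "disk_form D G = - 1"
    "disk_form E F = - 1"
    "disk_form E G = - 1" "disk_form F G = - 1"
  shows "quad D E F G"
proof -
  have ED: "vtangent E D" using assms(1) vtangent_commute by blast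
  have DF: "vtangent D F" and DG: "vtangent D G" using vtangent_transfer[OF assms(1)] assms by auto
  have EF: "vtangent E F" and EG: "vtangent E G" using vtangent_transfer[OF ED] assms by auto
  have "vtangent F G" using vtangent_transfer[of F E G] EF assms vtangent_commute by blast
  then show ?thesis using assms(1) DF DG EF EG by (simp add: quad_def)
qed

lemma quad_gram:
  assumes "quad D E F G"
  shows "disk_form D D = 1" "disk_form E E = 1" "disk_form F F = 1" "disk_form G G = 1"
    "disk_form D E = - 1" "disk_form D F = - 1" "disk_form D G = - 1"
    "disk_form E F = - 1" "disk_form E G = - 1" "disk_form F G = - 1"
    "disk_form E D = - 1" "disk_form F D = - 1" "disk_form G D = - 1"
    "disk_form F E = - 1" "disk_form G E = - 1" "disk_form G F = - 1"
  using assms unfolding quad_def vtangent_def by (metis disk_form_commute)+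

text \<open>A vector \<open>N\<close> orthogonal to the three given ones exists by dimension and is
  spacelike, because it is orthogonal to the null vector \<open>D + E\<close> without being a
  multiple of it. A suitable multiple of \<open>N\<close> added to \<open>D + E + F\<close> is a
  fourth vector.\<close>

lemma quad_exists:
  assumes DE: "vtangent D E" and DF: "vtangent D F" and EF: "vtangent E F"
  obtains G where "quad D E F G"
proof -
  \<comment> \<open>\<open>J\<close> turns the form into the Euclidean inner product, so that
    Euclidean orthogonality supplies \<open>N\<close>.\<close>
  define J :: "disk_vec \<Rightarrow> disk_vec" where "J = (\<lambda>(k, k', w). (- k' / 2, - k / 2, w))"
  have J: "disk_form x y = J x \<bullet> y" for x y
    by (auto simp: disk_form_def J_def inner_prod_def split: prod.split) argo
  have "dim (J ` {D, E, F}) \<le> card (J ` {D, E, F})" by (intro dim_le_card') auto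
  also have "\<dots> \<le> 3" by (intro order_trans[OF card_image_le]) (auto simp: card_insert_if)
  also have "3 < DIM(disk_vec)" by simp
  finally obtain N where N: "N \<noteq> 0" "\<And>y. y \<in> span (J ` {D, E, F}) \<Longrightarrow> orthogonal N y"
    using orthogonal_to_subspace_exists by blast
  have N0: "disk_form D N = 0" "disk_form E N = 0" "disk_form F N = 0"
    using N(2)[OF span_base, of "J D"] N(2)[OF span_base, of "J E"] N(2)[OF span_base, of "J F"]
    by (simp_all add: J orthogonal_def inner_commute[of N])
  have g: "disk_form D D = 1" "disk_form E E = 1" "disk_form F F = 1" "disk_form D E = -1" "disk_form D F = -1" "disk_form E F = -1"
    "disk_form E D = -1" "disk_form F D = -1" "disk_form F E = -1"
    using assms unfolding vtangent_def by (metis disk_form_commute)+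
  have null: "disk_form (D + E) (D + E) = 0" "D + E \<noteq> 0" "disk_form (D + E) N = 0"
    using g N0 DE by (auto simp: disk_form_simps vtangent_def tau_def simp flip: fst_add snd_add)
  have "disk_form N N \<noteq> 0"
  proof
    assume "disk_form N N = 0"
    then obtain t where t: "N = t *\<^sub>R (D + E)" using orthogonal_to_null(2)[OF null] by blast
    then have "t = 0" using N0(3) g by (simp add: disk_form_simps)
    then show False using t N by simp
  qed
  then have pos: "disk_form N N > 0" using orthogonal_to_null(1)[OF null] by simp
  \<comment> \<open>\<open>D + E + F\<close> has product -1 with \<open>D\<close>, \<open>E\<close>,
    \<open>F\<close> and self-product -3, so the orthogonal correction needs self-product 4.\<close>
  define s where "s = 2 / sqrt (disk_form N N)"
  have s: "s * s * disk_form N N = 4" using pos by (simp add: s_def field_simps)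
  define G where "G = D + E + F + s *\<^sub>R N"
  have "quad D E F G"
    by (rule quadI[OF DE])
      (use g N0 N0[unfolded disk_form_commute[of _ N]] s in \<open>simp_all add: G_def disk_form_simps algebra_simps\<close>)
  then show ?thesis by (rule that)
qed

lemma quad_span:
  assumes "quad D E F G"
  obtains a b c d where "x = a *\<^sub>R D + b *\<^sub>R E + c *\<^sub>R F + d *\<^sub>R G"
proof -
  \<comment> \<open>The type \<open>disk_vec\<close> doubles as the space of coefficients;
    injectivity of \<open>h\<close>, which holds because the Gram matrix is invertible, then yields
    surjectivity.\<close>
  define h :: "disk_vec \<Rightarrow> disk_vec" where
    "h = (\<lambda>y. fst y *\<^sub>R D + fst (snd y) *\<^sub>R E + Re (snd (snd y)) *\<^sub>R F + Im (snd (snd y)) *\<^sub>R G)"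
  have lin: "linear h"
    by (rule linearI) (simp_all add: h_def algebra_simps)
  have "y = 0" if "h y = 0" for y
  proof -
    have "disk_form (h y) D = 0" "disk_form (h y) E = 0" "disk_form (h y) F = 0" "disk_form (h y) G = 0"
      by (simp_all add: that disk_form_simps)
    then show ?thesis
      by (cases y) (auto simp: h_def disk_form_simps quad_gram[OF assms] complex_eq_iff zero_prod_def)
  qed
  then have "inj h" by (simp add: linear_injective_0[OF lin])
  then have "surj h" by (rule linear_injective_imp_surjective[OF lin]) (rule refl)
  then obtain y where "x = h y" by blast
  then show ?thesis using that by (simp add: h_def)
qed

text \<open>The three products force \<open>X = a (D + E + F) + (1 - a) G\<close>, and unit length
  leaves \<open>a (a - 2) = 0\<close>.\<close>

lemma quad_fourth:
  assumes q: "quad D E F G" and "vtangent X D" "vtangent X E" "vtangent X F"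
  shows "X = G \<or> X = 2 *\<^sub>R (D + E + F) - G"
proof -
  obtain a b c d where X: "X = a *\<^sub>R D + b *\<^sub>R E + c *\<^sub>R F + d *\<^sub>R G" by (rule quad_span[OF q])
  have "disk_form X D = -1" "disk_form X E = -1" "disk_form X F = -1" and XX: "disk_form X X = 1"
    using assms by (auto simp: vtangent_def)
  then have e: "a - b - c - d = -1" "b - a - c - d = -1" "c - a - b - d = -1"
    by (simp_all add: X disk_form_simps quad_gram[OF q])
  then have bc: "b = a" "c = a" "d = 1 - a" by linarith+
  have "a * (a - 2) = 0"
    using XX by (simp add: X bc disk_form_simps quad_gram[OF q] algebra_simps)
  then have "a = 0 \<or> a = 2" by simp
  then show ?thesis
    by (auto simp: X bc algebra_simps scaleR_2)
qed

text \<open>Descartes' circle theorem: curvature is the product with a fixed vector, and expanding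
  in the basis \<open>D, E, F, G\<close> that this vector is null relates the four
  curvatures.\<close>

lemma descartes:
  assumes q: "quad D E F G"
  shows "(fst G - fst D - fst E - fst F)\<^sup>2 = 4 * (fst D * fst E + fst D * fst F + fst E * fst F)"
proof -
  \<comment> \<open>the null vector that represents the curvature functional\<close>
  define nu :: disk_vec where "nu = (0, - 2, 0)"
  have nu: "disk_form nu x = fst x" for x by (simp add: nu_def disk_form_def)
  obtain a b c d where X: "nu = a *\<^sub>R D + b *\<^sub>R E + c *\<^sub>R F + d *\<^sub>R G" by (rule quad_span[OF q])
  have k: "fst D = a - b - c - d" "fst E = b - a - c - d" "fst F = c - a - b - d"
    "fst G = d - a - b - c"
    by (simp_all flip: nu) (simp_all add: X disk_form_simps quad_gram[OF q])
  have "disk_form nu nu = 0" by (simp add: nu_def disk_form_def)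
  then have "a * fst D + b * fst E + c * fst F + d * fst G = 0"
    by (subst (asm) (2) X) (simp add: disk_form_simps nu)
  then show ?thesis unfolding k by (simp add: algebra_simps power2_eq_square)
qed

section \<open>Disks as vectors\<close>

text \<open>The value \<open>w = - n\<close> for a half-plane is the limit of \<open>w = \<kappa> c\<close> over round disks growing to it.\<close>

fun vec_of :: "gdisk \<Rightarrow> disk_vec" where
  "vec_of (RoundDisk c r) = (1 / r, ((norm c)\<^sup>2 - r\<^sup>2) / r, c /\<^sub>R r)"
| "vec_of (ExteriorDisk c r) = (- 1 / r, - ((norm c)\<^sup>2 - r\<^sup>2) / r, - (c /\<^sub>R r))"
| "vec_of (HalfPlane n t) = (0, - 2 * t, - n)"

lemma fst_vec_of: "fst (vec_of D) = curvature D"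
  by (cases D) auto

lemma disk_form_vec_of_self: "is_disk D \<Longrightarrow> disk_form (vec_of D) (vec_of D) = 1"
  by (cases D) (auto simp: disk_form_def dot_square_norm field_simps power2_eq_square)

lemma vec_of_inject:
  assumes "is_disk D" "is_disk E" "vec_of D = vec_of E"
  shows "D = E"
proof -
  have k: "curvature D = curvature E" using assms(3) by (metis fst_vec_of)
  have w: "snd (snd (vec_of D)) = snd (snd (vec_of E))" "fst (snd (vec_of D)) = fst (snd (vec_of E))"
    using assms(3) by simp_all
  have neq: "1 / r \<noteq> - (1 / r')" "- (1 / r) \<noteq> 1 / r'" if "r > 0" "r' > 0" for r r' :: real
    using that divide_pos_pos[of 1 r] divide_pos_pos[of 1 r'] by linarith+
  show ?thesis using assms(1,2) k w neq by (cases D; cases E) auto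
qed

text \<open>The sign of \<open>k\<close> decides the kind of disk. For \<open>k \<noteq> 0\<close>
  the center is \<open>w / k\<close> and the radius \<open>1 / |k|\<close>; the normalisation then
  accounts for \<open>k'\<close>.\<close>

lemma vec_of_surj:
  assumes "disk_form x x = 1"
  obtains D where "is_disk D" "vec_of D = x"
proof -
  obtain k k' w where x: "x = (k, k', w)" by (cases x) auto
  have eq: "(norm w)\<^sup>2 - k * k' = 1" using assms by (simp add: x disk_form_def power2_norm_eq_inner algebra_simps)
  consider "k > 0" | "k < 0" | "k = 0" by linarith
  then show ?thesis
  proof cases
    case 1
    have "((norm w / k)\<^sup>2 - (1 / k)\<^sup>2) * k = k'"
      using 1 eq by (simp add: field_simps power2_eq_square)
    then show ?thesis using 1 that[of "RoundDisk (w /\<^sub>R k) (1 / k)"] by (simp add: x norm_divide divide_simps)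
  next
    case 2
    have "((norm w / k)\<^sup>2 - (1 / k)\<^sup>2) * k = k'"
      using 2 eq by (simp add: field_simps power2_eq_square)
    then show ?thesis using 2 that[of "ExteriorDisk (w /\<^sub>R k) (- 1 / k)"] by (simp add: x norm_divide divide_simps)
  next
    case 3
    then have "norm w = 1" using eq by (simp add: power2_eq_1_iff) (smt (verit) norm_ge_zero)
    then show ?thesis using 3 that[of "HalfPlane (- w) (- k' / 2)"] by (simp add: x)
  qed
qed

section \<open>Tangency of disks in terms of centers, radii and normals\<close>

lemma disk_topology:
  shows "r > 0 \<Longrightarrow> interior (closure (- cball (c :: complex) r)) = - cball c r"
    and "r > 0 \<Longrightarrow> frontier (closure (- cball (c :: complex) r)) = sphere c r"
    and "norm n = 1 \<Longrightarrow> interior {z. n \<bullet> z \<le> t} = {z :: complex. n \<bullet> z < t}"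
    and "norm n = 1 \<Longrightarrow> frontier {z. n \<bullet> z \<le> t} = {z :: complex. n \<bullet> z = t}"
proof -
  assume "norm n = 1"
  then have "n \<noteq> 0" by auto
  then show "interior {z. n \<bullet> z \<le> t} = {z. n \<bullet> z < t}" "frontier {z. n \<bullet> z \<le> t} = {z. n \<bullet> z = t}"
    by (simp_all add: interior_halfspace_le frontier_halfspace_le)
qed (auto simp: closure_complement interior_complement frontier_def)

text \<open>Equality in the triangle inequality puts a common point on the segment of centers, at
  distance \<open>r\<close> from \<open>c\<close>.\<close>

lemma sphere_meet_outside:
  fixes c c' :: complex
  assumes "r > 0" "r' > 0" "dist c c' = r + r'"
  shows "\<exists>p. sphere c r \<inter> sphere c' r' = {p}"
proof
  let ?p = "c + (r / (r + r')) *\<^sub>R (c' - c)"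
  have n: "norm (c' - c) = r + r'" using assms(3) by (simp add: dist_norm norm_minus_commute)
  show "sphere c r \<inter> sphere c' r' = {?p}"
  proof (intro equalityI subsetI)
    fix x assume "x \<in> sphere c r \<inter> sphere c' r'"
    then have x: "norm (x - c) = r" "norm (c' - x) = r'" by (auto simp: dist_norm norm_minus_commute)
    have "norm ((x - c) + (c' - x)) = norm (x - c) + norm (c' - x)" using x n by simp
    then have e: "norm (x - c) *\<^sub>R (c' - x) = norm (c' - x) *\<^sub>R (x - c)" unfolding norm_triangle_eq .
    have "(r + r') *\<^sub>R (x - c) = r *\<^sub>R (c' - c)" using e unfolding x by (simp add: algebra_simps)
    then have "(1 / (r + r')) *\<^sub>R ((r + r') *\<^sub>R (x - c)) = (1 / (r + r')) *\<^sub>R (r *\<^sub>R (c' - c))" by (rule arg_cong)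
    then have "x - c = (r / (r + r')) *\<^sub>R (c' - c)" using assms by simp
    then show "x \<in> {?p}" by (simp add: algebra_simps)
  next
    fix x assume "x \<in> {?p}"
    then have x: "x = ?p" by simp
    have "c' - x = (1 - r / (r + r')) *\<^sub>R (c' - c)" unfolding x by (simp add: algebra_simps)
    also have "1 - r / (r + r') = r' / (r + r')" using assms by (simp add: field_simps)
    finally have "c' - x = (r' / (r + r')) *\<^sub>R (c' - c)" .
    then have "norm (c' - x) = r'" using n assms by simp
    moreover have "norm (x - c) = r" using n assms unfolding x by simp
    ultimately show "x \<in> sphere c r \<inter> sphere c' r'" by (simp add: dist_norm norm_minus_commute)
  qed
qed

text \<open>Again equality in the triangle inequality, now with \<open>c'\<close> between
  \<open>c\<close> and the common point.\<close>

lemma sphere_meet_inside: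
  fixes c c' :: complex
  assumes "0 < r'" "r' < r" "dist c c' = r - r'"
  shows "\<exists>p. sphere c r \<inter> sphere c' r' = {p}"
proof
  let ?p = "c + (r / (r - r')) *\<^sub>R (c' - c)"
  have n: "norm (c' - c) = r - r'" using assms(3) by (simp add: dist_norm norm_minus_commute)
  show "sphere c r \<inter> sphere c' r' = {?p}"
  proof (intro equalityI subsetI)
    fix x assume "x \<in> sphere c r \<inter> sphere c' r'"
    then have x: "norm (x - c') = r'" "norm (x - c) = r" by (auto simp: dist_norm norm_minus_commute)
    have "norm ((c' - c) + (x - c')) = norm (c' - c) + norm (x - c')" using x n by simp
    then have e: "norm (c' - c) *\<^sub>R (x - c') = norm (x - c') *\<^sub>R (c' - c)" unfolding norm_triangle_eq .
    have "(r - r') *\<^sub>R (x - c) = r *\<^sub>R (c' - c)" using e unfolding x n by (simp add: algebra_simps)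
    then have "(1 / (r - r')) *\<^sub>R ((r - r') *\<^sub>R (x - c)) = (1 / (r - r')) *\<^sub>R (r *\<^sub>R (c' - c))" by (rule arg_cong)
    then have "x - c = (r / (r - r')) *\<^sub>R (c' - c)" using assms by simp
    then show "x \<in> {?p}" by (simp add: algebra_simps)
  next
    fix x assume "x \<in> {?p}"
    then have x: "x = ?p" by simp
    have "c' - x = (1 - r / (r - r')) *\<^sub>R (c' - c)" unfolding x by (simp add: algebra_simps)
    also have "1 - r / (r - r') = - r' / (r - r')" using assms by (simp add: field_simps)
    finally have "c' - x = (- r' / (r - r')) *\<^sub>R (c' - c)" .
    then have "norm (c' - x) = r'" using n assms by simp
    moreover have "norm (x - c) = r" using n assms unfolding x by simp
    ultimately show "x \<in> sphere c r \<inter> sphere c' r'" by (simp add: dist_norm norm_minus_commute)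
  qed
qed

text \<open>Disjoint interiors bound the distance of the centers from below, a common boundary point
  bounds it from above.\<close>

lemma tangent_round_round:
  "tangent (RoundDisk c r) (RoundDisk c' r') \<longleftrightarrow> r > 0 \<and> r' > 0 \<and> dist c c' = r + r'"
proof (cases "r > 0 \<and> r' > 0")
  case True
  have "ball c r \<inter> ball c' r' = {} \<longleftrightarrow> r + r' \<le> dist c c'"
  proof
    assume d: "ball c r \<inter> ball c' r' = {}"
    show "r + r' \<le> dist c c'"
    proof (rule ccontr)
      assume lt: "\<not> r + r' \<le> dist c c'"
      \<comment> \<open>This point divides the segment of centers in the ratio
        \<open>r : r'\<close>; it lies in both balls when they overlap.\<close>
      let ?p = "c + (r / (r + r')) *\<^sub>R (c' - c)"
      have "c' - ?p = (1 - r / (r + r')) *\<^sub>R (c' - c)" by (simp add: algebra_simps)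
      also have "1 - r / (r + r') = r' / (r + r')" using True by (simp add: field_simps)
      finally have "dist c' ?p = r' * (dist c c' / (r + r'))"
        using True by (simp add: dist_norm norm_minus_commute)
      moreover have "dist c ?p = r * (dist c c' / (r + r'))"
        using True by (simp add: dist_norm norm_minus_commute)
      moreover have "dist c c' / (r + r') < 1" using lt True by simp
      ultimately have "?p \<in> ball c r \<inter> ball c' r'"
        using True mult_strict_left_mono[of "dist c c' / (r + r')" 1] by fastforce
      then show False using d by blast
    qed
  next
    assume "r + r' \<le> dist c c'"
    then show "ball c r \<inter> ball c' r' = {}" by (rule disjoint_ballI)
  qed
  moreover have "dist c c' \<le> r + r'" if "sphere c r \<inter> sphere c' r' = {p}" for p
  proof -
    have "p \<in> sphere c r \<inter> sphere c' r'" using that by blast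
    then show ?thesis using dist_triangle[of c c' p] by (simp add: dist_commute)
  qed
  ultimately show ?thesis using True sphere_meet_outside[of r r' c c']
    by (auto simp: tangent_def disk_topology)
qed (auto simp: tangent_def)

lemma tangent_exterior_round:
  "tangent (ExteriorDisk c r) (RoundDisk c' r') \<longleftrightarrow> 0 < r' \<and> r' < r \<and> dist c c' = r - r'"
proof (cases "r > 0 \<and> r' > 0")
  case True
  have "- cball c r \<inter> ball c' r' = {} \<longleftrightarrow> ball c' r' \<subseteq> cball c r" by blast
  also have "\<dots> \<longleftrightarrow> dist c c' + r' \<le> r" using True by (simp add: ball_subset_cball_iff dist_commute)
  finally have 1: "- cball c r \<inter> ball c' r' = {} \<longleftrightarrow> dist c c' + r' \<le> r" .
  \<comment> \<open>The second conjunct rules out coinciding circles, which share at least the two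
    points \<open>c + r\<close> and \<open>c - r\<close>.\<close>
  have 2: "r \<le> dist c c' + r' \<and> (r = r' \<longrightarrow> c \<noteq> c')" if s: "sphere c r \<inter> sphere c' r' = {p}" for p
  proof
    have "p \<in> sphere c r \<inter> sphere c' r'" using s by blast
    then show "r \<le> dist c c' + r'" using dist_triangle[of c p c'] by (simp add: dist_commute)
    show "r = r' \<longrightarrow> c \<noteq> c'"
    proof (intro impI notI)
      assume "r = r'" "c = c'"
      then have "c + of_real r \<in> {p}" "c - of_real r \<in> {p}" using s True by (auto simp flip: s simp: dist_norm)
      then have "of_real r = (0::complex)" by (simp add: algebra_simps)
      then show False using True by simp
    qed
  qed
  show ?thesis
  proof
    assume "tangent (ExteriorDisk c r) (RoundDisk c' r')"
    then obtain p where d: "- cball c r \<inter> ball c' r' = {}" and p: "sphere c r \<inter> sphere c' r' = {p}"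
      using True by (auto simp: tangent_def disk_topology)
    have "dist c c' = r - r'" using d 1 2[OF p] by linarith
    moreover have "r \<noteq> r'" using 2[OF p] calculation by auto
    ultimately show "0 < r' \<and> r' < r \<and> dist c c' = r - r'"
      using True by (smt (verit) zero_le_dist)
  next
    assume "0 < r' \<and> r' < r \<and> dist c c' = r - r'"
    then show "tangent (ExteriorDisk c r) (RoundDisk c' r')"
      using True 1 sphere_meet_inside[of r' r c c']
      by (auto simp: tangent_def disk_topology)
  qed
qed (auto simp: tangent_def)

lemma half_plane_ball_disjoint:
  fixes n c :: complex
  assumes "norm n = 1" "r > 0"
  shows "{z. n \<bullet> z < t} \<inter> ball c r = {} \<longleftrightarrow> t + r \<le> n \<bullet> c"
proof
  assume L: "{z. n \<bullet> z < t} \<inter> ball c r = {}"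
  show "t + r \<le> n \<bullet> c"
  proof (rule field_le_epsilon)
    fix e :: real assume "e > 0"
    \<comment> \<open>The cutoff at 0 keeps the point in the ball when \<open>e\<close> exceeds
      \<open>r\<close>.\<close>
    define s where "s = max 0 (r - e)"
    have "c - s *\<^sub>R n \<in> ball c r" using assms \<open>e > 0\<close> by (auto simp: s_def dist_norm)
    then have "\<not> n \<bullet> (c - s *\<^sub>R n) < t" using L by blast
    then have "t \<le> n \<bullet> c - s" using assms by (simp add: inner_diff_right norm_eq_1)
    then show "t + r \<le> n \<bullet> c + e" by (simp add: s_def)
  qed
next
  assume R: "t + r \<le> n \<bullet> c"
  have False if "n \<bullet> z < t" "dist c z < r" for z
  proof -
    have "n \<bullet> (c - z) \<le> norm n * norm (c - z)" by (rule norm_cauchy_schwarz)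
    then show False using that R assms by (simp add: inner_diff_right dist_norm)
  qed
  then show "{z. n \<bullet> z < t} \<inter> ball c r = {}" by auto
qed

lemma line_meet_sphere:
  fixes n c :: complex
  assumes "norm n = 1" "r > 0" "n \<bullet> c = t + r"
  shows "{z. n \<bullet> z = t} \<inter> sphere c r = {c - r *\<^sub>R n}"
proof (intro equalityI subsetI)
  fix z assume "z \<in> {z. n \<bullet> z = t} \<inter> sphere c r"
  then have z: "n \<bullet> z = t" "norm (c - z) = r" by (auto simp: dist_norm)
  have "n \<bullet> (c - z) = norm n * norm (c - z)" using assms z by (simp add: inner_diff_right)
  then have "norm n *\<^sub>R (c - z) = norm (c - z) *\<^sub>R n" unfolding norm_cauchy_schwarz_eq .
  then show "z \<in> {c - r *\<^sub>R n}" using assms z by (simp add: algebra_simps)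
qed (use assms in \<open>auto simp: dist_norm inner_diff_right norm_eq_1\<close>)

lemma tangent_half_round:
  "tangent (HalfPlane n t) (RoundDisk c r) \<longleftrightarrow> norm n = 1 \<and> r > 0 \<and> n \<bullet> c = t + r"
proof (cases "norm n = 1 \<and> r > 0")
  case True
  have "n \<bullet> c \<le> t + r" if "{z. n \<bullet> z = t} \<inter> sphere c r = {p}" for p
  proof -
    have p: "n \<bullet> p = t" "norm (c - p) = r" using that by (auto simp: dist_norm)
    have "n \<bullet> (c - p) \<le> norm n * norm (c - p)" by (rule norm_cauchy_schwarz)
    then show ?thesis using p True by (simp add: inner_diff_right)
  qed
  then show ?thesis using True half_plane_ball_disjoint[of n r t c] line_meet_sphere[of n r c t]
    by (auto simp: tangent_def disk_topology)
qed (auto simp: tangent_def)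

lemma tangent_half_half:
  "tangent (HalfPlane n t) (HalfPlane n' t') \<longleftrightarrow> norm n = 1 \<and> n' = - n \<and> t + t' < 0"
proof (cases "norm n = 1 \<and> norm n' = 1")
  case True
  show ?thesis
  proof
    assume "tangent (HalfPlane n t) (HalfPlane n' t')"
    then have d: "{z. n \<bullet> z < t} \<inter> {z. n' \<bullet> z < t'} = {}" and f: "{z. n \<bullet> z = t} \<inter> {z. n' \<bullet> z = t'} = {}"
      using True by (auto simp: tangent_def disk_topology)
    have nn: "n' = - n"
    proof (rule ccontr)
      assume "n' \<noteq> - n"
      then have "n \<bullet> (- n') \<noteq> norm n * norm (- n')"
        using True norm_cauchy_schwarz_eq[of n "- n'"] by auto
      then have lt: "n \<bullet> n' > - 1" using norm_cauchy_schwarz[of n "- n'"] True by simp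
      \<comment> \<open>If the normals are not opposite, \<open>-(n + n')\<close> points into both
        half-planes; this \<open>s\<close> reaches far enough to be inside both.\<close>
      define s where "s = (\<bar>t\<bar> + \<bar>t'\<bar> + 1) / (1 + n \<bullet> n')"
      have "s * (1 + n \<bullet> n') = \<bar>t\<bar> + \<bar>t'\<bar> + 1" using lt by (simp add: s_def)
      then have "n \<bullet> (- s *\<^sub>R (n + n')) < t" "n' \<bullet> (- s *\<^sub>R (n + n')) < t'"
        using True by (simp_all add: inner_add_right norm_eq_1 inner_commute[of n' n] algebra_simps)
      then show False using d by blast
    qed
    have "t + t' \<le> 0"
    proof (rule ccontr)
      assume "\<not> t + t' \<le> 0"
      \<comment> \<open>\<open>(t - t') / 2\<close> is the level of the middle of the overlapping
        strip.\<close>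
      then have "n \<bullet> (((t - t') / 2) *\<^sub>R n) < t" "n' \<bullet> (((t - t') / 2) *\<^sub>R n) < t'"
        using True by (simp_all add: nn norm_eq_1 field_simps)
      then show False using d by blast
    qed
    moreover have "t + t' \<noteq> 0"
    proof
      assume "t + t' = 0"
      then have "n \<bullet> (t *\<^sub>R n) = t" "n' \<bullet> (t *\<^sub>R n) = t'" using True by (simp_all add: nn norm_eq_1)
      then show False using f by blast
    qed
    ultimately show "norm n = 1 \<and> n' = - n \<and> t + t' < 0" using nn True by auto
  next
    assume R: "norm n = 1 \<and> n' = - n \<and> t + t' < 0"
    then show "tangent (HalfPlane n t) (HalfPlane n' t')"
      using disk_topology(3,4)[of "- n" t'] by (auto simp: tangent_def disk_topology)
  qed
qed (auto simp: tangent_def)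

lemma not_tangent_exterior_exterior: "\<not> tangent (ExteriorDisk c r) (ExteriorDisk c' r')"
proof
  assume "tangent (ExteriorDisk c r) (ExteriorDisk c' r')"
  then have "- cball c r \<inter> - cball c' r' = {}" by (auto simp: tangent_def disk_topology)
  then have "cball c r \<union> cball c' r' = UNIV" by blast
  then have "bounded (UNIV :: complex set)" by (metis bounded_Un bounded_cball)
  then show False using not_bounded_UNIV by blast
qed

lemma not_tangent_half_exterior: "\<not> tangent (HalfPlane n t) (ExteriorDisk c r)"
proof
  assume T: "tangent (HalfPlane n t) (ExteriorDisk c r)"
  then have d: "{z. n \<bullet> z < t} \<inter> - cball c r = {}" and n: "norm n = 1"
    by (auto simp: tangent_def disk_topology)
  define s where "s = \<bar>n \<bullet> c\<bar> + \<bar>t\<bar> + \<bar>r\<bar> + 1"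
  have "c - s *\<^sub>R n \<in> {z. n \<bullet> z < t} \<inter> - cball c r"
    using n by (auto simp: s_def dist_norm inner_diff_right dot_square_norm)
  then show False using d by blast
qed

section \<open>Agreement of geometric tangency with tangency of vectors\<close>

lemma tangent_commute: "tangent D E \<longleftrightarrow> tangent E D"
  unfolding tangent_def by (auto simp: Int_commute)

text \<open>The leading two coordinates of a null vector have nonnegative product, so the first
  decides the time direction, and the second does when the first vanishes. For a sum of two disk
  vectors the first is the sum of curvatures.\<close>

lemma null_tau_pos:
  assumes "disk_form x x = 0"
  shows "tau x > 0 \<longleftrightarrow> fst x > 0 \<or> fst x = 0 \<and> fst (snd x) > 0"
  using null_signs(2,3)[OF assms] by (auto simp: tau_def) (smt (verit))+

lemma disk_form_round_round:
  assumes "r > 0" "r' > 0"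
  shows "disk_form (vec_of (RoundDisk c r)) (vec_of (RoundDisk c' r')) = (r\<^sup>2 + r'\<^sup>2 - (dist c c')\<^sup>2) / (2 * r * r')"
proof -
  have eq: "(dist c c')\<^sup>2 = (norm c)\<^sup>2 + (norm c')\<^sup>2 - 2 * (c \<bullet> c')"
    by (simp add: dist_norm power2_norm_eq_inner inner_diff_left inner_diff_right inner_commute)
  show ?thesis unfolding eq using assms by (simp add: disk_form_def field_simps power2_eq_square)
qed

lemma vec_of_exterior: "vec_of (ExteriorDisk c r) = - vec_of (RoundDisk c r)"
  by (simp add: diff_divide_distrib)

lemma disk_form_half_round:
  assumes "r > 0"
  shows "disk_form (vec_of (HalfPlane n t)) (vec_of (RoundDisk c r)) = (t - n \<bullet> c) / r"
  using assms by (simp add: disk_form_def field_simps)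

lemma vtangent_vec_of_iff:
  assumes "is_disk D" "is_disk E"
  shows "vtangent (vec_of D) (vec_of E) \<longleftrightarrow> disk_form (vec_of D) (vec_of E) = - 1 \<and>
    (curvature D + curvature E > 0 \<or>
     curvature D + curvature E = 0 \<and> fst (snd (vec_of D)) + fst (snd (vec_of E)) > 0)"
proof (cases "disk_form (vec_of D) (vec_of E) = - 1")
  case True
  have "disk_form (vec_of D + vec_of E) (vec_of D + vec_of E) = 0"
    using True assms disk_form_commute[of "vec_of E" "vec_of D"] by (simp add: disk_form_simps disk_form_vec_of_self)
  from null_tau_pos[OF this] show ?thesis using True assms
    by (simp add: vtangent_def disk_form_vec_of_self fst_vec_of)
qed (simp add: vtangent_def)

text \<open>The hypotheses on the kinds select one order for each pair of different kinds;
  \<open>tangent_iff\<close> obtains the other order by symmetry.\<close>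

lemma tangent_iff_aux:
  assumes "is_disk D" "is_disk E" and "\<exists>c r. D = RoundDisk c r \<Longrightarrow> \<exists>c r. E = RoundDisk c r"
    and "\<exists>c r. D = ExteriorDisk c r \<Longrightarrow> \<not> (\<exists>n t. E = HalfPlane n t)"
  shows "tangent D E \<longleftrightarrow> vtangent (vec_of D) (vec_of E)"
proof (cases D)
  case D: (RoundDisk c r)
  then obtain c' r' where E: "E = RoundDisk c' r'" using assms by blast
  have r: "r > 0" "r' > 0" using assms D E by auto
  have "1 / r + 1 / r' > 0" using r by (simp add: add_pos_pos)
  moreover have "(r\<^sup>2 + r'\<^sup>2 - (dist c c')\<^sup>2) / (2 * r * r') = - 1 \<longleftrightarrow> (dist c c')\<^sup>2 = (r + r')\<^sup>2"
    using r by (simp add: divide_eq_eq power2_sum) argo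
  moreover have "(dist c c')\<^sup>2 = (r + r')\<^sup>2 \<longleftrightarrow> dist c c' = r + r'"
    by (rule power2_eq_iff_nonneg) (use r in simp_all)
  ultimately show ?thesis
    using r assms(1,2) disk_form_round_round[OF r]
    unfolding vtangent_vec_of_iff[OF assms(1,2)] unfolding D E tangent_round_round
    by simp
next
  case D: (ExteriorDisk c r)
  have r: "r > 0" using assms D by auto
  show ?thesis
  proof (cases E)
    case E: (RoundDisk c' r')
    have r': "r' > 0" using assms E by auto
    have disk_form_eq: "disk_form (vec_of D) (vec_of E) = - ((r\<^sup>2 + r'\<^sup>2 - (dist c c')\<^sup>2) / (2 * r * r'))"
      unfolding D E vec_of_exterior disk_form_minus_left disk_form_round_round[OF r r'] ..
    have k_eq: "curvature D + curvature E = 1 / r' - 1 / r" by (simp add: D E)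
    have 1: "1 / r' - 1 / r > 0 \<longleftrightarrow> r' < r" "1 / r' - 1 / r = 0 \<longleftrightarrow> r' = r"
      using r r' by (auto simp: field_simps)
    have 2: "- ((r\<^sup>2 + r'\<^sup>2 - (dist c c')\<^sup>2) / (2 * r * r')) = - 1 \<longleftrightarrow> (dist c c')\<^sup>2 = (r - r')\<^sup>2"
      using r r' by (simp add: divide_eq_eq power2_diff) argo
    have 3: "(dist c c')\<^sup>2 = (r - r')\<^sup>2 \<longleftrightarrow> dist c c' = r - r'" if "r' < r"
      by (rule power2_eq_iff_nonneg) (use that in simp_all)
    \<comment> \<open>For equal circles the exterior and the disk have opposite vectors, so their
      sum is not future directed.\<close>
    have 4: "fst (snd (vec_of D)) + fst (snd (vec_of E)) = 0" if "r' = r" "(dist c c')\<^sup>2 = (r - r')\<^sup>2"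
      using that by (simp add: D E flip: add_divide_distrib)
    have "tangent D E \<longleftrightarrow> r' < r \<and> dist c c' = r - r'"
      using r' unfolding D E tangent_exterior_round by simp
    then show ?thesis unfolding vtangent_vec_of_iff[OF assms(1,2)] disk_form_eq k_eq 1 2 using 3 4 by auto
  next
    case E: (ExteriorDisk c' r')
    then have "r' > 0" using assms by auto
    then have "1 / r + 1 / r' > 0" using r by (simp add: add_pos_pos)
    then show ?thesis
      unfolding vtangent_vec_of_iff[OF assms(1,2)] unfolding D E by (simp add: not_tangent_exterior_exterior)
  qed (use assms D in blast)
next
  case D: (HalfPlane n t)
  have n: "norm n = 1" using assms D by auto
  show ?thesis
  proof (cases E)
    case E: (RoundDisk c r)
    have r: "r > 0" using assms E by auto
    have "(t - n \<bullet> c) / r = - 1 \<longleftrightarrow> n \<bullet> c = t + r" using r by (auto simp: divide_eq_eq)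
    then show ?thesis using r n disk_form_half_round[OF r, of n t c]
      unfolding vtangent_vec_of_iff[OF assms(1,2)] unfolding D E tangent_half_round by simp
  next
    case E: (ExteriorDisk c r)
    then have "r > 0" using assms by auto
    then show ?thesis unfolding vtangent_vec_of_iff[OF assms(1,2)] unfolding D E
      by (simp add: not_tangent_half_exterior)
  next
    case E: (HalfPlane n' t')
    have n': "norm n' = 1" using assms E by auto
    have "n \<bullet> n' = - 1 \<longleftrightarrow> n \<bullet> (- n') = norm n * norm (- n')" using n n' by auto
    also have "\<dots> \<longleftrightarrow> n' = - n" unfolding norm_cauchy_schwarz_eq using n n' by auto
    finally show ?thesis using n
      unfolding vtangent_vec_of_iff[OF assms(1,2)] unfolding D E tangent_half_half by (auto simp: disk_form_def)
  qed
qed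

lemma tangent_iff: "tangent D E \<longleftrightarrow> is_disk D \<and> is_disk E \<and> vtangent (vec_of D) (vec_of E)"
proof (cases "is_disk D \<and> is_disk E")
  case True
  then show ?thesis
    using tangent_iff_aux[of D E] tangent_iff_aux[of E D] tangent_commute[of D E]
      vtangent_commute[of "vec_of D" "vec_of E"] by (cases D; cases E) auto
qed (auto simp: tangent_def)

section \<open>The disks tangent to a fixed disk\<close>

definition idet :: "int \<times> int \<Rightarrow> int \<times> int \<Rightarrow> int" where
  "idet f g = fst f * snd g - snd f * fst g"

definition icomb :: "int \<Rightarrow> int \<times> int \<Rightarrow> int \<Rightarrow> int \<times> int \<Rightarrow> int \<times> int" where
  "icomb m f n g = (m * fst f + n * fst g, m * snd f + n * snd g)"

text \<open>Adding \<open>D\<close> gives a quadratic map whose values at (1,0), (0,1), (1,1) are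
  \<open>D + E\<close>, \<open>D + F\<close>, \<open>D + G\<close>.\<close>

definition ford :: "disk_vec \<Rightarrow> disk_vec \<Rightarrow> disk_vec \<Rightarrow> disk_vec \<Rightarrow> int \<times> int \<Rightarrow> disk_vec" where
  "ford D E F G f = (real_of_int (fst f))\<^sup>2 *\<^sub>R (D + E) + (real_of_int (snd f))\<^sup>2 *\<^sub>R (D + F)
     + (real_of_int (fst f) * real_of_int (snd f)) *\<^sub>R (G - D - E - F) - D"

lemma idet_add: "idet f (f + g) = idet f g" "idet g (f + g) = - idet f g" "idet f (- g) = - idet f g"
  "idet f f = 0"
  by (simp_all add: idet_def algebra_simps)

lemma idet_commute: "idet g f = - idet f g"
  by (simp add: idet_def)

lemma ford_basis: "ford D E F G (1, 0) = E" "ford D E F G (0, 1) = F" "ford D E F G (1, 1) = G"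
  by (simp_all add: ford_def)

lemma ford_uminus: "ford D E F G (- f) = ford D E F G f"
  by (simp add: ford_def)

text \<open>The parallelogram law of that quadratic map. The right-hand side is the second solution
  in \<open>quad_fourth\<close>, so exchanging \<open>f + g\<close> for \<open>f - g\<close> is a
  replacement in a Descartes quadruple.\<close>

lemma ford_parallelogram:
  "ford D E F G (f - g) = 2 *\<^sub>R (D + ford D E F G f + ford D E F G g) - ford D E F G (f + g)"
proof -
  obtain A B C where ABC: "A = D + E" "B = D + F" "C = G - D - E - F" by blast
  show ?thesis unfolding ford_def ABC[symmetric] scaleR_2 by (simp add: algebra_simps power2_eq_square)
qed

text \<open>A quadratic map rewritten in the coordinates of another pair of arguments. It moves the
  parametrisation from a cluster of the orbit to two given disks.\<close>

lemma ford_rebase: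
  "ford D (ford D E F G f) (ford D E F G g) (ford D E F G (f + g)) (m, n) = ford D E F G (icomb m f n g)"
proof -
  obtain A B C where ABC: "A = D + E" "B = D + F" "C = G - D - E - F" by blast
  obtain a b c d where abcd: "f = (a, b)" "g = (c, d)" by (cases f; cases g)
  show ?thesis unfolding ford_def ABC[symmetric] icomb_def abcd
    by (simp add: algebra_simps power2_eq_square)
qed

text \<open>\<open>A\<close>, \<open>B\<close>, \<open>C\<close> are orthogonal to \<open>D\<close>,
  and the vectors \<open>m^2 A + n^2 B + m n C\<close> are null; two of them have product -2 times
  the squared determinant.\<close>

lemma disk_form_ford:
  assumes "quad D E F G"
  shows "disk_form D (ford D E F G f) = - 1" "disk_form (ford D E F G f) D = - 1"
    and "disk_form (ford D E F G f) (ford D E F G g) = 1 - 2 * (real_of_int (idet f g))\<^sup>2"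
proof -
  define A B C where ABC: "A = D + E" "B = D + F" "C = G - D - E - F"
  have t: "disk_form A A = 0" "disk_form A B = - 2" "disk_form B A = - 2" "disk_form B B = 0"
    "disk_form A C = 0" "disk_form C A = 0"
    "disk_form B C = 0" "disk_form C B = 0" "disk_form C C = 4"
    "disk_form D A = 0" "disk_form A D = 0" "disk_form D B = 0" "disk_form B D = 0"
    "disk_form D C = 0" "disk_form C D = 0" "disk_form D D = 1"
    by (simp_all add: ABC disk_form_simps quad_gram[OF assms])
  have X: "ford D E F G f = (real_of_int (fst f))\<^sup>2 *\<^sub>R A + (real_of_int (snd f))\<^sup>2 *\<^sub>R B
     + (real_of_int (fst f) * real_of_int (snd f)) *\<^sub>R C - D" for f
    by (simp add: ford_def ABC)
  show "disk_form D (ford D E F G f) = - 1" "disk_form (ford D E F G f) D = - 1"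
    by (simp_all add: X disk_form_simps t)
  show "disk_form (ford D E F G f) (ford D E F G g) = 1 - 2 * (real_of_int (idet f g))\<^sup>2"
    by (simp add: X disk_form_simps t idet_def) (simp add: algebra_simps power2_eq_square)
qed

lemma quad_tau: "quad D E F G \<Longrightarrow> tau (D + E) > 0" "quad D E F G \<Longrightarrow> tau (D + F) > 0"
  by (simp_all add: quad_def vtangent_def)

text \<open>The null vector in question has products \<open>-2 n^2\<close> and \<open>-2 m^2\<close>
  with \<open>D + E\<close> and \<open>D + F\<close>; one of them is negative, which fixes the time
  direction.\<close>

lemma vtangent_ford:
  assumes q: "quad D E F G" and "f \<noteq> 0"
  shows "vtangent D (ford D E F G f)"
proof -
  let ?X = "ford D E F G f"
  have XX: "disk_form ?X ?X = 1" by (simp add: disk_form_ford[OF q] idet_def)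
  have null: "disk_form (D + ?X) (D + ?X) = 0"
    by (simp add: disk_form_simps disk_form_ford(1,2)[OF q] XX quad_gram[OF q])
  have E: "disk_form E ?X = 1 - 2 * (real_of_int (snd f))\<^sup>2"
    using disk_form_ford(3)[OF q, of "(1, 0)" f] by (simp add: ford_basis idet_def)
  have F: "disk_form F ?X = 1 - 2 * (real_of_int (fst f))\<^sup>2"
    using disk_form_ford(3)[OF q, of "(0, 1)" f] by (simp add: ford_basis idet_def)
  have "tau (D + ?X) > 0"
  proof (cases "snd f = 0")
    case True
    then have "fst f \<noteq> 0" using assms(2) by (simp add: prod_eq_iff)
    then have "disk_form (D + F) (D + ?X) < 0"
      unfolding disk_form_simps disk_form_ford(1)[OF q] F by (simp add: quad_gram[OF q])
    moreover have "disk_form (D + F) (D + F) = 0" by (simp add: disk_form_simps quad_gram[OF q])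
    ultimately show ?thesis using null_forward null quad_tau[OF q] by blast
  next
    case False
    then have "disk_form (D + E) (D + ?X) < 0"
      unfolding disk_form_simps disk_form_ford(1)[OF q] E by (simp add: quad_gram[OF q])
    moreover have "disk_form (D + E) (D + E) = 0" by (simp add: disk_form_simps quad_gram[OF q])
    ultimately show ?thesis using null_forward null quad_tau[OF q] by blast
  qed
  then show ?thesis using XX disk_form_ford(1)[OF q] quad_gram(1)[OF q] by (simp add: vtangent_def)
qed

lemma idet_square_1:
  assumes "(idet f g)\<^sup>2 = 1"
  shows "(real_of_int (idet f g))\<^sup>2 = 1" "f \<noteq> 0" "coprime (fst f) (snd f)"
proof -
  show "(real_of_int (idet f g))\<^sup>2 = 1" using assms by (metis of_int_1 of_int_power)
  show "f \<noteq> 0" using assms by (auto simp: idet_def)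
  show "coprime (fst f) (snd f)"
  proof (rule coprimeI)
    fix k assume "k dvd fst f" "k dvd snd f"
    then have "k dvd idet f g" by (simp add: idet_def)
    then have "k dvd (idet f g)\<^sup>2" by (simp add: power2_eq_square)
    then show "is_unit k" using assms by simp
  qed
qed

lemma quad_ford:
  assumes q: "quad D E F G" and d: "(idet f g)\<^sup>2 = 1"
  shows "quad D (ford D E F G f) (ford D E F G g) (ford D E F G (f + g))"
  by (rule quadI[OF vtangent_ford[OF q idet_square_1(2)[OF d]]])
    (use idet_square_1(1)[OF d] in \<open>simp_all add: disk_form_ford[OF q] idet_add\<close>)

text \<open>An induction principle: exchange, sign change and addition lead from the standard basis
  to a basis starting with any given coprime pair. It serves both for reachability and for
  membership in closed sets.\<close>

lemma euclid_closure:
  fixes C :: "int \<times> int \<Rightarrow> int \<times> int \<Rightarrow> bool"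
  assumes base: "C (1, 0) (0, 1)"
    and flip: "\<And>f g. C f g \<Longrightarrow> C g f"
    and neg: "\<And>f g. C f g \<Longrightarrow> C f (- g)"
    and add: "\<And>f g. C f g \<Longrightarrow> C f (f + g)"
    and "coprime m n"
  shows "\<exists>h. C (m, n) h"
proof -
  have nonneg: "\<exists>h. C (icomb m f n g) h" if "C f g" "coprime m n" "m \<ge> 0" "n \<ge> 0" for f g m n
    using that
  proof (induction "nat (m + n)" arbitrary: f g m n rule: less_induct)
    case less
    consider "n = 0" | "m = 0" | "0 < n" "n \<le> m" | "0 < m" "m < n" using less.prems by linarith
    then show ?case
    proof cases
      case 1
      then have "m = 1" using less.prems by simp
      then show ?thesis using 1 less.prems(1) by (intro exI[of _ g]) (simp add: icomb_def)
    next
      case 2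
      then have "n = 1" using less.prems by simp
      then show ?thesis using 2 flip[OF less.prems(1)] by (intro exI[of _ f]) (simp add: icomb_def)
    next
      case 3
      \<comment> \<open>The subtractive Euclidean algorithm:
        \<open>m f + n g = (m - n) f + n (f + g)\<close>.\<close>
      have "coprime (m - n) n" using less.prems(2) by (simp add: coprime_iff_gcd_eq_1 gcd_diff1)
      then have "\<exists>h. C (icomb (m - n) f n (f + g)) h"
        using 3 by (intro less.hyps add less.prems(1)) auto
      then show ?thesis by (simp add: icomb_def algebra_simps)
    next
      case 4
      have "coprime m (n - m)" using less.prems(2)
        by (simp add: coprime_iff_gcd_eq_1 gcd_diff1 gcd.commute[of m])
      then have "\<exists>h. C (icomb m (g + f) (n - m) g) h"
        using 4 by (intro less.hyps flip[OF add[OF flip[OF less.prems(1)]]]) auto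
      then show ?thesis by (simp add: icomb_def algebra_simps)
    qed
  qed
  have neg': "C (- f) g" if "C f g" for f g using flip[OF neg[OF flip[OF that]]] .
  \<comment> \<open>The signs of \<open>m\<close> and \<open>n\<close> are absorbed into the initial
    basis, leaving nonnegative coefficients.\<close>
  have "C (if m \<ge> 0 then (1, 0) else - (1, 0)) (if n \<ge> 0 then (0, 1) else - (0, 1))"
    using base neg[OF base] neg'[OF base] neg'[OF neg[OF base]] by simp
  from nonneg[OF this, of "\<bar>m\<bar>" "\<bar>n\<bar>"] show ?thesis
    using assms(5) by (simp add: icomb_def split: if_splits)
qed

section \<open>Clusters and their orbit\<close>

definition cluster :: "disk_vec set \<Rightarrow> bool" where
  "cluster Q \<longleftrightarrow> card Q = 4 \<and> (\<forall>x\<in>Q. disk_form x x = 1) \<and> (\<forall>x\<in>Q. \<forall>y\<in>Q. x \<noteq> y \<longrightarrow> vtangent x y)"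

text \<open>For a member \<open>x\<close> this is twice the sum of the other three minus
  \<open>x\<close>, the second solution in \<open>quad_fourth\<close>.\<close>

definition opposite :: "disk_vec set \<Rightarrow> disk_vec \<Rightarrow> disk_vec" where
  "opposite Q x = 2 *\<^sub>R (\<Sum>Q) - 3 *\<^sub>R x"

definition swap :: "disk_vec set \<Rightarrow> disk_vec \<Rightarrow> disk_vec set" where
  "swap Q x = insert (opposite Q x) (Q - {x})"

lemma cluster_finite: "cluster Q \<Longrightarrow> finite Q"
  unfolding cluster_def by (metis card.infinite zero_neq_numeral)

lemma cluster_disk_form_sum:
  assumes "cluster Q" "y \<in> Q"
  shows "disk_form (\<Sum>Q) y = - 2"
proof -
  have "disk_form (\<Sum>Q) y = (\<Sum>x\<in>Q. disk_form x y)" by (simp add: disk_form_sum_left)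
  also have "\<dots> = disk_form y y + (\<Sum>x\<in>Q - {y}. disk_form x y)"
    using assms cluster_finite by (simp add: sum.remove)
  also have "(\<Sum>x\<in>Q - {y}. disk_form x y) = (\<Sum>x\<in>Q - {y}. - 1)"
    using assms by (intro sum.cong) (auto simp: cluster_def vtangent_def)
  also have "\<dots> = - 3" using assms by (simp add: cluster_def)
  finally show ?thesis using assms by (simp add: cluster_def)
qed

text \<open>All values follow from \<open>\<Sum>Q\<close> having product -2 with each member, hence
  self-product -8; for instance -7 is \<open>2 * (-2) - 3\<close>.\<close>

lemma disk_form_opposite:
  assumes "cluster Q" "x \<in> Q"
  shows "y \<in> Q \<Longrightarrow> disk_form (opposite Q x) y = (if y = x then - 7 else - 1)"
    and "disk_form (opposite Q x) (opposite Q x) = 1"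
proof -
  show *: "disk_form (opposite Q x) y = (if y = x then - 7 else - 1)" if "y \<in> Q" for y
    using assms that cluster_disk_form_sum[OF assms(1)] by (auto simp: opposite_def disk_form_simps cluster_def vtangent_def)
  have "disk_form (\<Sum>Q) (\<Sum>Q) = (\<Sum>y\<in>Q. disk_form y (\<Sum>Q))" by (simp add: disk_form_sum_left)
  also have "\<dots> = (\<Sum>y\<in>Q. - 2)"
    using cluster_disk_form_sum[OF assms(1)] disk_form_commute by (intro sum.cong) metis+
  also have "\<dots> = - 8" using assms by (simp add: cluster_def)
  finally have "disk_form (\<Sum>Q) (\<Sum>Q) = - 8" .
  then show "disk_form (opposite Q x) (opposite Q x) = 1"
    using assms cluster_disk_form_sum[OF assms] disk_form_commute[of x "\<Sum>Q"]
    by (simp add: opposite_def disk_form_simps cluster_def)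
qed

lemma opposite_notin:
  assumes "cluster Q" "x \<in> Q"
  shows "opposite Q x \<notin> Q"
proof
  assume "opposite Q x \<in> Q"
  then have "disk_form (opposite Q x) (opposite Q x) \<noteq> 1"
    using disk_form_opposite(1)[OF assms, of "opposite Q x"] by (auto split: if_splits)
  then show False using disk_form_opposite(2)[OF assms] by simp
qed

lemma cluster_swap:
  assumes Q: "cluster Q" and x: "x \<in> Q"
  shows "cluster (swap Q x)"
proof -
  have fin: "finite Q" by (rule cluster_finite[OF Q])
  have "card (swap Q x) = 4"
    using Q x fin opposite_notin[OF Q x] by (simp add: swap_def cluster_def)
  moreover have T: "vtangent (opposite Q x) y" if y: "y \<in> Q - {x}" for y
  proof -
    \<comment> \<open>A third member \<open>z\<close> is tangent to \<open>y\<close>, and from this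
      pair the future direction is transferred.\<close>
    have "card {x, y} < card Q" using Q by (simp add: cluster_def card_insert_if)
    then have "\<not> Q \<subseteq> {x, y}" using card_mono[of "{x, y}" Q] by auto
    then obtain z where z: "z \<in> Q" "z \<noteq> x" "z \<noteq> y" by blast
    have "vtangent y z" using Q y z by (auto simp: cluster_def)
    then have "vtangent y (opposite Q x)"
      by (rule vtangent_transfer) (use disk_form_opposite[OF Q x] y z disk_form_commute[of y "opposite Q x"]
        disk_form_commute[of z "opposite Q x"] in auto)
    then show ?thesis using vtangent_commute by blast
  qed
  ultimately show ?thesis
    using Q disk_form_opposite(2)[OF Q x] unfolding cluster_def swap_def
    using vtangent_commute by blast
qed

lemma swap_swap:
  assumes Q: "cluster Q" and x: "x \<in> Q"
  shows "swap (swap Q x) (opposite Q x) = Q"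
proof -
  have "\<Sum>(swap Q x) = opposite Q x + (\<Sum>Q - x)"
    using opposite_notin[OF Q x] cluster_finite[OF Q] x by (simp add: swap_def sum_diff1)
  then have "opposite (swap Q x) (opposite Q x) = x"
    by (simp add: opposite_def prod_eq_iff complex_eq_iff algebra_simps)
  then show ?thesis using opposite_notin[OF Q x] x by (auto simp: swap_def)
qed

lemma quad_swap_last: "quad D E F G \<Longrightarrow> quad D E G F"
  unfolding quad_def using vtangent_commute by blast

lemma quad_distinct:
  assumes "quad D E F G"
  shows "D \<noteq> E" "D \<noteq> F" "D \<noteq> G" "E \<noteq> F" "E \<noteq> G" "F \<noteq> G"
  using quad_gram[OF assms] by auto

lemma quad_cluster:
  assumes "quad D E F G"
  shows "cluster {D, E, F, G}"
proof -
  have "card {D, E, F, G} = 4" using quad_distinct[OF assms] by simp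
  moreover have "\<forall>x\<in>{D, E, F, G}. disk_form x x = 1" using quad_gram(1-4)[OF assms] by blast
  moreover have "\<forall>x\<in>{D, E, F, G}. \<forall>y\<in>{D, E, F, G}. x \<noteq> y \<longrightarrow> vtangent x y"
    using assms vtangent_commute unfolding quad_def by blast
  ultimately show ?thesis by (simp add: cluster_def)
qed

lemma cluster_quad:
  assumes Q: "cluster Q" and "D \<in> Q"
  obtains E F G where "Q = {D, E, F, G}" "quad D E F G"
proof -
  have "card (Q - {D}) = 3" using assms by (simp add: cluster_def)
  then obtain E F G where EFG: "Q - {D} = {E, F, G}" "E \<noteq> F" "E \<noteq> G" "F \<noteq> G"
    by (metis card_3_iff)
  then have "E \<noteq> D" "F \<noteq> D" "G \<noteq> D" and eq: "Q = {D, E, F, G}" using assms(2) by blast+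
  then have "quad D E F G" using Q EFG(2-4) unfolding cluster_def quad_def by auto
  then show ?thesis using eq that by blast
qed

lemma swap_quad:
  assumes "quad A B C X"
  shows "swap {A, B, C, X} X = {A, B, C, 2 *\<^sub>R (A + B + C) - X}"
proof -
  have "\<Sum>{A, B, C, X} = A + B + C + X" using quad_distinct[OF assms] by (simp add: add.assoc)
  then have "opposite {A, B, C, X} X = 2 *\<^sub>R (A + B + C) - X"
    by (simp add: opposite_def prod_eq_iff complex_eq_iff algebra_simps)
  then show ?thesis using quad_distinct[OF assms] by (auto simp: swap_def)
qed

section \<open>Clusters that contain the fixed disk and clusters that have lost it\<close>

definition farey :: "disk_vec \<Rightarrow> disk_vec \<Rightarrow> disk_vec \<Rightarrow> disk_vec \<Rightarrow> int \<times> int \<Rightarrow> int \<times> int \<Rightarrow> disk_vec set" where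
  "farey D E F G f g = {D, ford D E F G f, ford D E F G g, ford D E F G (f + g)}"

lemma farey_commute: "farey D E F G g f = farey D E F G f g"
  unfolding farey_def by (simp add: add.commute insert_commute)

text \<open>The new vector sits at \<open>f - g\<close>; as \<open>ford\<close> is even, the result
  is the cluster of \<open>f\<close> and \<open>- g\<close>.\<close>

lemma swap_farey_sum:
  assumes "quad D E F G" "(idet f g)\<^sup>2 = 1"
  shows "swap (farey D E F G f g) (ford D E F G (f + g)) = farey D E F G f (- g)"
  unfolding farey_def swap_quad[OF quad_ford[OF assms]] ford_uminus
  using ford_parallelogram[of D E F G f g] by simp

lemma swap_farey_second:
  assumes "quad D E F G" "(idet f g)\<^sup>2 = 1"
  shows "swap (farey D E F G f g) (ford D E F G g) = farey D E F G f (f + g)"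
proof -
  let ?X = "ford D E F G"
  \<comment> \<open>The parallelogram law for \<open>f\<close> and \<open>f + g\<close>, whose
    difference is \<open>- g\<close>.\<close>
  have "2 *\<^sub>R (D + ?X f + ?X (f + g)) - ?X g = ?X (f + (f + g))"
    using ford_parallelogram[of D E F G f "f + g"] ford_uminus[of D E F G g] by (simp add: algebra_simps)
  moreover have "farey D E F G f g = {D, ?X f, ?X (f + g), ?X g}"
    unfolding farey_def by (simp add: insert_commute)
  ultimately show ?thesis
    using swap_quad[OF quad_swap_last[OF quad_ford[OF assms]]] by (simp add: farey_def)
qed

lemma swap_farey:
  assumes q: "quad D E F G" and d: "(idet f g)\<^sup>2 = 1" and x: "x \<in> farey D E F G f g" "x \<noteq> D"
  shows "\<exists>f' g'. (idet f' g')\<^sup>2 = 1 \<and> swap (farey D E F G f g) x = farey D E F G f' g'"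
proof -
  have d': "(idet g f)\<^sup>2 = 1" using d by (simp add: idet_commute[of g f])
  consider "x = ford D E F G f" | "x = ford D E F G g" | "x = ford D E F G (f + g)"
    using x by (auto simp: farey_def)
  then show ?thesis
  proof cases
    case 1
    then have "swap (farey D E F G f g) x = farey D E F G g (g + f)"
      using swap_farey_second[OF q d'] by (simp add: farey_commute)
    moreover have "(idet g (g + f))\<^sup>2 = 1" using d' by (simp add: idet_add)
    ultimately show ?thesis by blast
  next
    case 2
    moreover have "(idet f (f + g))\<^sup>2 = 1" using d by (simp add: idet_add)
    ultimately show ?thesis using swap_farey_second[OF q d] by blast
  next
    case 3
    moreover have "(idet f (- g))\<^sup>2 = 1" using d by (simp add: idet_add)
    ultimately show ?thesis using swap_farey_sum[OF q d] by blast
  qed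
qed

lemma farey_cluster:
  assumes "quad D E F G" "(idet f g)\<^sup>2 = 1"
  shows "cluster (farey D E F G f g)"
  unfolding farey_def by (rule quad_cluster[OF quad_ford[OF assms]])

text \<open>\<open>deep D E F G Q y\<close>: the reduced sequence of replacements leading to \<open>Q\<close> has replaced \<open>D\<close>, and
  \<open>y\<close> is the vector it adjoined last.\<close>

inductive deep :: "disk_vec \<Rightarrow> disk_vec \<Rightarrow> disk_vec \<Rightarrow> disk_vec \<Rightarrow> disk_vec set \<Rightarrow> disk_vec \<Rightarrow> bool" for D E F G where
  leave: "(idet f g)\<^sup>2 = 1 \<Longrightarrow> Q = farey D E F G f g \<Longrightarrow> deep D E F G (swap Q D) (opposite Q D)"
| descend: "deep D E F G Q y \<Longrightarrow> x \<in> Q \<Longrightarrow> x \<noteq> y \<Longrightarrow> deep D E F G (swap Q x) (opposite Q x)"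

text \<open>All products with \<open>D\<close> are at most -1 and that of \<open>y\<close> is least,
  so replacing \<open>x \<noteq> y\<close> creates a product of at most twice that of
  \<open>y\<close> minus that of \<open>x\<close>, hence at most that of \<open>y\<close>. Thus
  \<open>D\<close> stays away, and members with product -1 are Ford vectors left from the moment
  \<open>D\<close> was replaced.\<close>

lemma deep_bound:
  assumes q: "quad D E F G" and "deep D E F G Q y"
  shows "cluster Q \<and> y \<in> Q \<and> disk_form y D < - 1 \<and> (\<forall>x\<in>Q. disk_form y D \<le> disk_form x D \<and>
    (disk_form x D < - 1 \<or> (\<exists>f. x = ford D E F G f \<and> coprime (fst f) (snd f)) \<and> disk_form x D = - 1))"
  using assms(2)
proof induction
  case (leave f g Q)
  have Q: "cluster Q" "D \<in> Q" using farey_cluster[OF q leave(1)] leave(2) by (auto simp: farey_def)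
  have cop: "coprime (fst f) (snd f)" "coprime (fst g) (snd g)" "coprime (fst (f + g)) (snd (f + g))"
  proof -
    have "(idet g f)\<^sup>2 = 1" using leave(1) by (simp add: idet_commute[of g f])
    moreover have "(idet (f + g) f)\<^sup>2 = 1"
      using leave(1) by (simp add: idet_commute[of "f + g" f] idet_add)
    ultimately show "coprime (fst f) (snd f)" "coprime (fst g) (snd g)" "coprime (fst (f + g)) (snd (f + g))"
      using leave(1) idet_square_1(3) by blast+
  qed
  have "(\<exists>f. x = ford D E F G f \<and> coprime (fst f) (snd f)) \<and> disk_form x D = - 1" if "x \<in> Q - {D}" for x
    using that cop unfolding leave(2) farey_def by (auto simp: disk_form_ford[OF q] simp del: split_paired_Ex)
  moreover have "disk_form (opposite Q D) D = - 7" using disk_form_opposite(1)[OF Q Q(2)] by simp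
  ultimately show ?case using cluster_swap[OF Q] by (auto simp: swap_def)
next
  case (descend Q y x)
  then have Q: "cluster Q" and x: "x \<in> Q" and y: "y \<in> Q" "disk_form y D < - 1" "x \<noteq> y"
    and le: "\<And>z. z \<in> Q \<Longrightarrow> disk_form y D \<le> disk_form z D"
    and K: "\<And>z. z \<in> Q \<Longrightarrow>
      disk_form z D < - 1 \<or> (\<exists>f. z = ford D E F G f \<and> coprime (fst f) (snd f)) \<and> disk_form z D = - 1"
    by blast+
  have fin: "finite Q" by (rule cluster_finite[OF Q])
  have "(\<Sum>z\<in>Q. disk_form z D) = disk_form x D + (\<Sum>z\<in>Q - {x}. disk_form z D)" using fin x by (simp add: sum.remove)
  also have "(\<Sum>z\<in>Q - {x}. disk_form z D) = disk_form y D + (\<Sum>z\<in>Q - {x} - {y}. disk_form z D)"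
    using fin y by (intro sum.remove) auto
  also have "(\<Sum>z\<in>Q - {x} - {y}. disk_form z D) \<le> 0"
  proof (rule sum_nonpos)
    fix z assume "z \<in> Q - {x} - {y}"
    then show "disk_form z D \<le> 0" using K[of z] by auto
  qed
  finally have "(\<Sum>z\<in>Q. disk_form z D) \<le> disk_form x D + disk_form y D" by simp
  moreover have "disk_form (opposite Q x) D = 2 * (\<Sum>z\<in>Q. disk_form z D) - 3 * disk_form x D"
    by (simp add: opposite_def disk_form_simps disk_form_sum_left)
  ultimately have "disk_form (opposite Q x) D \<le> disk_form y D" using le[OF x] by linarith
  then show ?case using cluster_swap[OF Q x] y le K by (fastforce simp: swap_def)
qed

section \<open>Orbits under replacement\<close>

definition reach :: "disk_vec set \<Rightarrow> disk_vec set \<Rightarrow> bool" where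
  "reach = (\<lambda>Q Q'. \<exists>x\<in>Q. Q' = swap Q x)\<^sup>*\<^sup>*"

lemma reach_refl: "reach Q Q"
  and reach_step: "reach Q Q' \<Longrightarrow> x \<in> Q' \<Longrightarrow> reach Q (swap Q' x)"
  and reach_trans: "reach Q Q' \<Longrightarrow> reach Q' Q'' \<Longrightarrow> reach Q Q''"
proof -
  show "reach Q Q" by (simp add: reach_def)
  show "reach Q (swap Q' x)" if "reach Q Q'" "x \<in> Q'"
    using that unfolding reach_def by (metis (mono_tags, lifting) rtranclp.rtrancl_into_rtrancl)
  show "reach Q Q''" if "reach Q Q'" "reach Q' Q''"
    using that unfolding reach_def by (rule rtranclp_trans)
qed

lemma reach_induct [consumes 1, case_names refl step]:
  assumes "reach Q Q'" "P Q" "\<And>Q' x. reach Q Q' \<Longrightarrow> P Q' \<Longrightarrow> x \<in> Q' \<Longrightarrow> P (swap Q' x)"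
  shows "P Q'"
  using assms unfolding reach_def by (induction rule: rtranclp_induct) blast+

lemma reach_cluster: "reach Q Q' \<Longrightarrow> cluster Q \<Longrightarrow> cluster Q'"
  by (induction rule: reach_induct) (auto intro: cluster_swap)

lemma reach_sym:
  assumes "reach Q Q'" "cluster Q"
  shows "reach Q' Q"
  using assms(1)
proof (induction rule: reach_induct)
  case refl
  then show ?case by (rule reach_refl)
next
  case (step Q' x)
  have Q': "cluster Q'" using reach_cluster step.hyps(1) assms(2) by blast
  have "reach (swap Q' x) (swap (swap Q' x) (opposite Q' x))"
    by (rule reach_step[OF reach_refl]) (simp add: swap_def)
  then show ?case using step.IH reach_trans swap_swap[OF Q' step.hyps(2)] by metis
qed

text \<open>In a deep cluster, \<open>x \<noteq> y\<close> is a further descent, while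
  \<open>x = y\<close> undoes the last replacement and returns to the preceding cluster; so
  non-reduced sequences are covered as well.\<close>

lemma reach_farey_or_deep:
  assumes q: "quad D E F G" and "reach {D, E, F, G} Q"
  shows "(\<exists>f g. (idet f g)\<^sup>2 = 1 \<and> Q = farey D E F G f g) \<or> (\<exists>y. deep D E F G Q y)"
  using assms(2)
proof (induction rule: reach_induct)
  case refl
  have "{D, E, F, G} = farey D E F G (1, 0) (0, 1)" by (simp add: farey_def ford_basis)
  moreover have "(idet (1, 0) (0, 1))\<^sup>2 = 1" by (simp add: idet_def)
  ultimately show ?case by blast
next
  case (step Q x)
  from step.IH show ?case
  proof (elim disjE exE conjE)
    fix f g assume f: "(idet f g)\<^sup>2 = 1" "Q = farey D E F G f g"
    show ?thesis
    proof (cases "x = D")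
      case True
      then show ?thesis using deep.leave[OF f] by blast
    next
      case False
      then show ?thesis using swap_farey[OF q f(1), of x] step.hyps(2) f(2) by blast
    qed
  next
    fix y assume y: "deep D E F G Q y"
    show ?thesis
    proof (cases "x = y")
      case False
      then show ?thesis using deep.descend[OF y step.hyps(2)] by blast
    next
      case True
      from y show ?thesis
      proof cases
        case (leave f g Q0)
        then have "cluster Q0" "D \<in> Q0" using farey_cluster[OF q leave(3)] by (auto simp: farey_def)
        then have "swap Q x = Q0" using True leave swap_swap by simp
        then show ?thesis using leave by blast
      next
        case (descend Q0 y0 x0)
        then have "cluster Q0" using deep_bound[OF q] by blast
        then have "swap Q x = Q0" using True descend swap_swap by simp
        then show ?thesis using descend by blast
      qed
    qed
  qed
qed

lemma reach_tangent_is_ford: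
  assumes q: "quad D E F G" and r: "reach {D, E, F, G} Q" and "X \<in> Q" and "vtangent X D"
  shows "\<exists>f. coprime (fst f) (snd f) \<and> X = ford D E F G f"
proof -
  have disk_form: "disk_form X D = - 1" and XD: "X \<noteq> D" using assms(4) by (auto simp: vtangent_def)
  from reach_farey_or_deep[OF q r] show ?thesis
  proof (elim disjE exE conjE)
    fix f g assume f: "(idet f g)\<^sup>2 = 1" "Q = farey D E F G f g"
    have "(idet g f)\<^sup>2 = 1" using f(1) by (simp add: idet_commute[of g f])
    moreover have "(idet (f + g) f)\<^sup>2 = 1"
      using f(1) by (simp add: idet_commute[of "f + g" f] idet_add)
    ultimately show ?thesis
      using f idet_square_1(3) XD assms(3) unfolding farey_def by blast
  next
    fix y assume "deep D E F G Q y"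
    then show ?thesis using deep_bound[OF q] assms(3) disk_form by fastforce
  qed
qed

text \<open>The moves of \<open>euclid_closure\<close> are realised by replacements: a sign change
  of \<open>g\<close> replaces the vector at \<open>f + g\<close>, an addition replaces the one at
  \<open>g\<close>.\<close>

lemma ford_reach:
  assumes q: "quad D E F G" and "coprime (fst f) (snd f)"
  shows "\<exists>Q. reach {D, E, F, G} Q \<and> ford D E F G f \<in> Q"
proof -
  define C where "C f g \<longleftrightarrow> (idet f g)\<^sup>2 = 1 \<and> reach {D, E, F, G} (farey D E F G f g)" for f g
  have "\<exists>h. C (fst f, snd f) h"
  proof (rule euclid_closure[OF _ _ _ _ assms(2)])
    show "C (1, 0) (0, 1)"
      by (simp add: C_def idet_def farey_def ford_basis reach_refl)
    show "C g f" if "C f g" for f g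
      using that by (simp add: C_def farey_commute[of D E F G g f] idet_commute[of g f])
    show "C f (- g)" if "C f g" for f g
      using that reach_step[of _ _ "ford D E F G (f + g)"] swap_farey_sum[OF q, of f g]
      by (fastforce simp: C_def idet_add farey_def[of D E F G f g])
    show "C f (f + g)" if "C f g" for f g
      using that reach_step[of _ _ "ford D E F G g"] swap_farey_second[OF q, of f g]
      by (fastforce simp: C_def idet_add farey_def[of D E F G f g])
  qed
  then obtain h where "C f h" by auto
  then show ?thesis by (auto simp: C_def farey_def)
qed

definition orbit :: "disk_vec set \<Rightarrow> disk_vec set" where
  "orbit Q = \<Union> {Q'. reach Q Q'}"

text \<open>Replacement is reversible, so the orbit may be based at any cluster it reaches, in
  particular at one containing \<open>D\<close>.\<close>

lemma orbit_quad:
  assumes "cluster Q" "D \<in> orbit Q"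
  obtains E F G where "quad D E F G" "orbit Q = orbit {D, E, F, G}"
proof -
  obtain Q' where Q': "reach Q Q'" "D \<in> Q'" using assms(2) by (auto simp: orbit_def)
  obtain E F G where EFG: "Q' = {D, E, F, G}" "quad D E F G"
    by (rule cluster_quad[OF reach_cluster[OF Q'(1) assms(1)] Q'(2)])
  have "orbit Q = orbit Q'"
    using reach_trans[OF Q'(1)] reach_trans[OF reach_sym[OF Q'(1) assms(1)]] by (auto simp: orbit_def)
  then show ?thesis using EFG that by blast
qed

definition adjoin_closed :: "disk_vec set \<Rightarrow> bool" where
  "adjoin_closed V \<longleftrightarrow> (\<forall>a b c x. a \<in> V \<longrightarrow> b \<in> V \<longrightarrow> c \<in> V \<longrightarrow> vtangent a b \<longrightarrow> vtangent a c \<longrightarrow> vtangent b c \<longrightarrow>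
     vtangent x a \<longrightarrow> vtangent x b \<longrightarrow> vtangent x c \<longrightarrow> x \<in> V)"

lemma vtangent_ford_ford:
  assumes q: "quad D E F G" and "vtangent (ford D E F G f) (ford D E F G g)"
  shows "(idet f g)\<^sup>2 = 1"
proof -
  have "(real_of_int (idet f g))\<^sup>2 = 1" using assms(2) by (simp add: vtangent_def disk_form_ford[OF q])
  then show ?thesis by (metis of_int_eq_1_iff of_int_power)
qed

lemma orbit_tangent_is_ford:
  assumes q: "quad D E F G" and "X \<in> orbit {D, E, F, G}" "vtangent X D"
  shows "\<exists>f. coprime (fst f) (snd f) \<and> X = ford D E F G f"
  using assms(2,3) reach_tangent_is_ford[OF q] unfolding orbit_def by blast

text \<open>Seen from \<open>a\<close>, the vectors \<open>b\<close> and \<open>c\<close> are Ford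
  vectors at \<open>f\<close>, \<open>g\<close> with determinant 1 or -1. By
  \<open>quad_fourth\<close> the new vector sits at \<open>f + g\<close> or \<open>f - g\<close>, a
  coprime pair, and is therefore reached.\<close>

lemma orbit_adjoin_closed:
  assumes "cluster Q"
  shows "adjoin_closed (orbit Q)"
  unfolding adjoin_closed_def
proof (intro allI impI)
  fix a b c x assume V: "a \<in> orbit Q" "b \<in> orbit Q" "c \<in> orbit Q"
    and t: "vtangent a b" "vtangent a c" "vtangent b c" and x: "vtangent x a" "vtangent x b" "vtangent x c"
  obtain E F G where q: "quad a E F G" and S: "orbit Q = orbit {a, E, F, G}"
    by (rule orbit_quad[OF assms V(1)])
  obtain f where f: "b = ford a E F G f"
    using orbit_tangent_is_ford[OF q] V(2) t(1) vtangent_commute S by blast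
  obtain g where g: "c = ford a E F G g"
    using orbit_tangent_is_ford[OF q] V(3) t(2) vtangent_commute S by blast
  have d: "(idet f g)\<^sup>2 = 1" using vtangent_ford_ford[OF q] t(3) f g by blast
  have "x = ford a E F G (f + g) \<or> x = ford a E F G (f - g)"
    using quad_fourth[OF quad_ford[OF q d]] x f g ford_parallelogram[of a E F G f g] by metis
  moreover have "(idet (f + g) f)\<^sup>2 = 1" "(idet (f - g) f)\<^sup>2 = 1"
    using d by (simp_all add: idet_def algebra_simps power2_commute)
  ultimately obtain h where "x = ford a E F G h" "coprime (fst h) (snd h)"
    using idet_square_1(3) by blast
  then show "x \<in> orbit Q" using ford_reach[OF q] unfolding S unfolding orbit_def by blast
qed

text \<open>Each addition in the Euclidean algorithm adjoins the vector at \<open>f + g\<close> to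
  the tangent triple of \<open>D\<close> and the vectors at \<open>f\<close> and \<open>g\<close>;
  sign changes are harmless because \<open>ford\<close> is even.\<close>

lemma adjoin_closed_ford:
  assumes V: "adjoin_closed V" and q: "quad D E F G" and in_V: "D \<in> V" "E \<in> V" "F \<in> V"
    and "coprime (fst f) (snd f)"
  shows "ford D E F G f \<in> V"
proof -
  define C where "C f g \<longleftrightarrow> (idet f g)\<^sup>2 = 1 \<and> ford D E F G f \<in> V \<and> ford D E F G g \<in> V" for f g
  have "\<exists>h. C (fst f, snd f) h"
  proof (rule euclid_closure[OF _ _ _ _ assms(6)])
    show "C (1, 0) (0, 1)"
      using in_V by (simp add: C_def idet_def ford_basis)
    show "C g f" if "C f g" for f g
      using that by (simp add: C_def idet_commute[of g f])
    show "C f (- g)" if "C f g" for f g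
      using that by (simp add: C_def idet_add ford_uminus)
    show "C f (f + g)" if C: "C f g" for f g
    proof -
      have d: "(idet f g)\<^sup>2 = 1" using C by (simp add: C_def)
      have "ford D E F G f \<in> V" "ford D E F G g \<in> V" using C by (simp_all add: C_def)
      then have "ford D E F G (f + g) \<in> V"
        using V in_V(1) quad_ford[OF q d, unfolded quad_def] vtangent_commute
        unfolding adjoin_closed_def by blast
      then show ?thesis using C by (simp add: C_def idet_add)
    qed
  qed
  then show ?thesis by (auto simp: C_def)
qed

section \<open>Tangency spinors\<close>

abbreviation wpart :: "disk_vec \<Rightarrow> complex" where "wpart x \<equiv> snd (snd x)"

text \<open>The complex part is curvature times center for circles, so
  \<open>A B (c_E - c_D)\<close> becomes \<open>A w_E - B w_D\<close>; this expression also covers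
  half-planes, which makes the clauses of the definition uniform.\<close>

lemma spinor_vec_of:
  assumes "tangency_spinor D E u"
  shows "u\<^sup>2 = fst (vec_of D) *\<^sub>R wpart (vec_of E) - fst (vec_of E) *\<^sub>R wpart (vec_of D)"
proof -
  have t: "tangent D E" using assms by (simp add: tangency_spinor_def)
  consider (round) "\<not> is_half_plane D" "\<not> is_half_plane E" | (first) "is_half_plane D"
    | (second) "\<not> is_half_plane D" "is_half_plane E" by blast
  then show ?thesis
  proof cases
    case round
    then show ?thesis using assms t
      by (cases D; cases E) (auto simp: tangency_spinor_def scaleR_conv_of_real field_simps tangent_def)
  next
    case first
    then obtain n s where D: "D = HalfPlane n s" by (cases D) auto
    show ?thesis using assms by (cases E) (auto simp: D tangency_spinor_def scaleR_conv_of_real)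
  next
    case second
    then obtain n s where E: "E = HalfPlane n s" by (cases E) auto
    have "\<not> tangent (ExteriorDisk c r) E" for c r
      unfolding E using not_tangent_half_exterior tangent_commute by blast
    then obtain c r where D: "D = RoundDisk c r" using second t by (cases D) auto
    have n: "norm n = 1" "r > 0" "n \<bullet> c = s + r"
      using t tangent_half_round tangent_commute unfolding D E by blast+
    obtain p where p: "p \<in> {z. n \<bullet> z = s} \<inter> sphere c r" "u\<^sup>2 = of_real (1 / r) * ((p - c) / of_real r)"
      using assms n by (auto simp: D E tangency_spinor_def disk_topology)
    have "p = c - r *\<^sub>R n" using p(1) line_meet_sphere[OF n] by blast
    then show ?thesis using p(2) n(2) by (simp add: D E scaleR_conv_of_real)
  qed
qed

text \<open>Squaring doubles angles: this is \<open>2 cos^2 t = 1 + cos (2 t)\<close> for the angle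
  \<open>t\<close> between \<open>u\<close> and \<open>v\<close>.\<close>

lemma complex_square_inner: "2 * (u \<bullet> v)\<^sup>2 = (norm u)\<^sup>2 * (norm v)\<^sup>2 + u\<^sup>2 \<bullet> v\<^sup>2" for u v :: complex
  unfolding cmod_power2 inner_complex_def by (simp add: power2_eq_square algebra_simps)

text \<open>After expansion, the normalisation and tangency relations cancel all second coordinates.
  With \<open>complex_square_inner\<close>, \<open>(u \<bullet> v)^2\<close> becomes the symmetric
  function in Descartes' theorem.\<close>

lemma spinor_inner:
  assumes "vtangent x y" "vtangent x z" "disk_form y z = - 1" and u: "u\<^sup>2 = fst x *\<^sub>R wpart y - fst y *\<^sub>R wpart x"
    and v: "v\<^sup>2 = fst x *\<^sub>R wpart z - fst z *\<^sub>R wpart x"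
  shows "u\<^sup>2 \<bullet> v\<^sup>2 = fst x * fst y + fst x * fst z + fst y * fst z - (fst x)\<^sup>2"
proof -
  define a b c a' b' c' where abc: "a = fst x" "b = fst y" "c = fst z"
    "a' = fst (snd x)" "b' = fst (snd y)" "c' = fst (snd z)"
  have e: "wpart y \<bullet> wpart z = (b * c' + b' * c) / 2 - 1" "wpart x \<bullet> wpart y = (a * b' + a' * b) / 2 - 1"
    "wpart x \<bullet> wpart z = (a * c' + a' * c) / 2 - 1" "wpart x \<bullet> wpart x = a * a' + 1"
    using assms(1-3) by (simp_all add: vtangent_def disk_form_def abc)
  have "u\<^sup>2 \<bullet> v\<^sup>2 = a * a * (wpart y \<bullet> wpart z) - a * c * (wpart x \<bullet> wpart y) - b * a * (wpart x \<bullet> wpart z)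
      + b * c * (wpart x \<bullet> wpart x)"
    unfolding u v abc[symmetric]
    by (simp add: inner_diff_left inner_diff_right inner_commute[of "wpart y" "wpart x"] algebra_simps)
  then show ?thesis unfolding e abc[symmetric] by (simp add: field_simps power2_eq_square)
qed

text \<open>The squared length of \<open>u^2\<close> is \<open>(a + b)^2\<close>; the future
  direction of \<open>x + y\<close> gives \<open>a + b \<ge> 0\<close> and settles the sign.\<close>

lemma spinor_norm:
  assumes "vtangent x y" and u: "u\<^sup>2 = fst x *\<^sub>R wpart y - fst y *\<^sub>R wpart x"
  shows "(norm u)\<^sup>2 = fst x + fst y"
proof -
  define a b a' b' where abc: "a = fst x" "b = fst y" "a' = fst (snd x)" "b' = fst (snd y)"
  have e: "wpart x \<bullet> wpart y = (a * b' + a' * b) / 2 - 1" "wpart x \<bullet> wpart x = a * a' + 1" "wpart y \<bullet> wpart y = b * b' + 1"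
    using assms(1) by (simp_all add: vtangent_def disk_form_def abc)
  have "u\<^sup>2 \<bullet> u\<^sup>2 = a * a * (wpart y \<bullet> wpart y) - 2 * a * b * (wpart x \<bullet> wpart y) + b * b * (wpart x \<bullet> wpart x)"
    unfolding u abc[symmetric]
    by (simp add: inner_diff_left inner_diff_right inner_commute[of "wpart y" "wpart x"] algebra_simps)
  also have "\<dots> = (a + b)\<^sup>2" unfolding e by (simp add: algebra_simps power2_eq_square)
  finally have "((norm u)\<^sup>2)\<^sup>2 = (a + b)\<^sup>2"
    by (simp add: dot_square_norm norm_power)
  moreover have "a + b \<ge> 0"
  proof -
    have "disk_form (x + y) (x + y) = 0" using assms(1) disk_form_commute[of y x] by (simp add: vtangent_def disk_form_simps)
    from null_signs(3)[OF this] show ?thesis using assms(1) by (simp add: vtangent_def abc)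
  qed
  ultimately have "(norm u)\<^sup>2 = a + b" by (metis power2_eq_imp_eq zero_le_power2)
  then show ?thesis by (simp add: abc)
qed

text \<open>The first coordinate is a binary quadratic form in \<open>f\<close>; \<open>s\<close>
  selects the \<open>g\<close> whose mixed term has the sign matching the chosen spinors.\<close>

lemma fst_ford_spinor:
  assumes "vtangent x y" "vtangent x z" "vtangent y z" and u: "u\<^sup>2 = fst x *\<^sub>R wpart y - fst y *\<^sub>R wpart x"
    and v: "v\<^sup>2 = fst x *\<^sub>R wpart z - fst z *\<^sub>R wpart x"
    and s: "fst g - fst x - fst y - fst z = 2 * (u \<bullet> v)"
  shows "fst (ford x y z g f) = (norm (real_of_int (fst f) *\<^sub>R u + real_of_int (snd f) *\<^sub>R v))\<^sup>2 - fst x"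
proof -
  have "(norm (real_of_int (fst f) *\<^sub>R u + real_of_int (snd f) *\<^sub>R v))\<^sup>2
    = (real_of_int (fst f))\<^sup>2 * (norm u)\<^sup>2 + (real_of_int (snd f))\<^sup>2 * (norm v)\<^sup>2
      + real_of_int (fst f) * real_of_int (snd f) * (2 * (u \<bullet> v))"
    unfolding power2_norm_eq_inner
    by (simp add: inner_add_left inner_add_right inner_commute[of v u] algebra_simps power2_eq_square)
  then show ?thesis
    unfolding spinor_norm[OF assms(1) u] spinor_norm[OF assms(2) v] s[symmetric] by (simp add: ford_def)
qed

section \<open>The corona in the packing\<close>

lemma packing_is_disk:
  assumes "mutually_tangent D1 D2 D3" "X \<in> generated_packing D1 D2 D3"
  shows "is_disk X"
  using assms(2) by induction (use assms(1) in \<open>auto simp: mutually_tangent_def tangent_def\<close>)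

lemma packing_adjoin_closed:
  assumes "mutually_tangent D1 D2 D3"
  shows "adjoin_closed (vec_of ` generated_packing D1 D2 D3)"
  unfolding adjoin_closed_def
proof (intro allI impI)
  fix a b c x assume V: "a \<in> vec_of ` generated_packing D1 D2 D3" "b \<in> vec_of ` generated_packing D1 D2 D3"
      "c \<in> vec_of ` generated_packing D1 D2 D3"
    and t: "vtangent a b" "vtangent a c" "vtangent b c" "vtangent x a" "vtangent x b" "vtangent x c"
  obtain E F G where EFG: "a = vec_of E" "b = vec_of F" "c = vec_of G" "E \<in> generated_packing D1 D2 D3"
    "F \<in> generated_packing D1 D2 D3" "G \<in> generated_packing D1 D2 D3" using V by blast
  obtain X where X: "is_disk X" "vec_of X = x" using vec_of_surj t(4) unfolding vtangent_def by metis
  have "X \<in> generated_packing D1 D2 D3"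
    by (rule generated_packing.adjoin[OF EFG(4-6)])
      (use t X EFG(1-3) packing_is_disk[OF assms] EFG(4-6) in \<open>simp_all add: mutually_tangent_def tangent_iff\<close>)
  then show "x \<in> vec_of ` generated_packing D1 D2 D3" using X by blast
qed

text \<open>The three initial disks are completed to a Descartes quadruple; its orbit is closed
  under adjoining, so the induction over the packing stays inside.\<close>

lemma packing_in_orbit:
  assumes "mutually_tangent D1 D2 D3"
  obtains Q where "cluster Q" "vec_of ` generated_packing D1 D2 D3 \<subseteq> orbit Q"
proof -
  obtain d where q: "quad (vec_of D1) (vec_of D2) (vec_of D3) d"
    using quad_exists assms unfolding mutually_tangent_def tangent_iff by metis
  define Q where "Q = {vec_of D1, vec_of D2, vec_of D3, d}"
  have Q: "cluster Q" unfolding Q_def by (rule quad_cluster[OF q])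
  have in_orbit: "Q \<subseteq> orbit Q" using reach_refl by (auto simp: orbit_def)
  have "vec_of X \<in> orbit Q" if "X \<in> generated_packing D1 D2 D3" for X
    using that
  proof induction
    case (adjoin E F G X)
    then show ?case using orbit_adjoin_closed[OF Q]
      unfolding adjoin_closed_def mutually_tangent_def tangent_iff by blast
  qed (use in_orbit in \<open>auto simp: Q_def\<close>)
  then show ?thesis using that Q by blast
qed

text \<open>Cramer's rule over the integers, the determinant being its own inverse.\<close>

lemma unimodular_solve:
  assumes "(idet f g)\<^sup>2 = 1" "coprime (fst h) (snd h)"
  obtains m n where "h = icomb m f n g" "coprime m n"
proof -
  define \<delta> where "\<delta> = idet f g"
  have \<delta>: "\<delta> * \<delta> = 1" using assms(1) by (simp add: \<delta>_def power2_eq_square)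
  define m n where mn: "m = \<delta> * idet h g" "n = \<delta> * idet f h"
  have "icomb m f n g = (\<delta> * idet f g * fst h, \<delta> * idet f g * snd h)"
    by (simp add: icomb_def mn idet_def algebra_simps)
  then have h: "h = icomb m f n g" using \<delta> by (simp add: \<delta>_def)
  have "coprime m n"
  proof (rule coprimeI)
    fix k assume "k dvd m" "k dvd n"
    then have "k dvd fst h" "k dvd snd h" by (simp_all add: h icomb_def)
    then show "is_unit k" using assms(2) coprime_common_divisor by blast
  qed
  then show ?thesis using h that by blast
qed

text \<open>The corona is first parametrised from some cluster through \<open>D\<close>, then from
  the pair \<open>E\<close>, \<open>F\<close> by \<open>ford_rebase\<close>. The sign of one
  argument remains free and matches \<open>G\<close> to the chosen signs of the spinors.\<close>

lemma corona_ford: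
  assumes \<A>: "apollonian_packing \<A>" and D: "D \<in> \<A>" and E: "E \<in> corona \<A> D" and F: "F \<in> corona \<A> D"
    and EF: "tangent E F" and u: "tangency_spinor D E u" and v: "tangency_spinor D F v"
  obtains G where "quad (vec_of D) (vec_of E) (vec_of F) G"
    "fst G - fst (vec_of D) - fst (vec_of E) - fst (vec_of F) = 2 * (u \<bullet> v)"
    "vec_of ` corona \<A> D = ford (vec_of D) (vec_of E) (vec_of F) G ` {f. coprime (fst f) (snd f)}"
proof -
  let ?d = "vec_of D" and ?e = "vec_of E" and ?f = "vec_of F"
  obtain D1 D2 D3 where mt: "mutually_tangent D1 D2 D3" and A: "\<A> = generated_packing D1 D2 D3"
    using \<A> by (auto simp: apollonian_packing_def)
  obtain Q where Q: "cluster Q" "vec_of ` \<A> \<subseteq> orbit Q" using packing_in_orbit[OF mt] A by blast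
  have in_A: "D \<in> \<A>" "E \<in> \<A>" "F \<in> \<A>" and tan: "tangent D E" "tangent D F"
    using D E F by (auto simp: corona_def)
  have t: "vtangent ?d ?e" "vtangent ?d ?f" "vtangent ?e ?f" using tan EF by (auto simp: tangent_iff)
  obtain a b c where q: "quad ?d a b c" and S: "orbit Q = orbit {?d, a, b, c}"
    using orbit_quad[OF Q(1), of ?d] Q(2) in_A by blast
  have ex: "\<exists>f. coprime (fst f) (snd f) \<and> vec_of X = ford ?d a b c f" if "X \<in> \<A>" "vtangent ?d (vec_of X)" for X
    using orbit_tangent_is_ford[OF q] that Q(2) S vtangent_commute by blast
  obtain f where f: "?e = ford ?d a b c f" using ex in_A t by blast
  obtain g0 where g0: "?f = ford ?d a b c g0" using ex in_A t by blast
  have d0: "(idet f g0)\<^sup>2 = 1" using vtangent_ford_ford[OF q] t(3) f g0 by metis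
  \<comment> \<open>Descartes' theorem and the spinor identities both express \<open>s^2\<close>,
    which determines \<open>s\<close> up to sign.\<close>
  define s where "s = fst (ford ?d a b c (f + g0)) - fst ?d - fst ?e - fst ?f"
  have "s\<^sup>2 = 4 * (fst ?d * fst ?e + fst ?d * fst ?f + fst ?e * fst ?f)"
    using descartes[OF quad_ford[OF q d0]] by (simp add: s_def f g0)
  also have "\<dots> = 4 * (u \<bullet> v)\<^sup>2"
    using complex_square_inner[of u v] spinor_inner[OF t(1,2) _ spinor_vec_of[OF u] spinor_vec_of[OF v]] t(3)
    unfolding spinor_norm[OF t(1) spinor_vec_of[OF u]] spinor_norm[OF t(2) spinor_vec_of[OF v]]
    by (simp add: vtangent_def algebra_simps power2_eq_square)
  also have "\<dots> = (2 * (u \<bullet> v))\<^sup>2" by (simp add: power_mult_distrib)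
  finally have "s = 2 * (u \<bullet> v) \<or> s = - (2 * (u \<bullet> v))" by (simp only: power2_eq_iff)
  \<comment> \<open>A sign change of \<open>g0\<close> keeps the vector of \<open>F\<close> but
    exchanges the fourth vector for its opposite, which reverses \<open>s\<close>.\<close>
  moreover have "fst (ford ?d a b c (f + - g0)) - fst ?d - fst ?e - fst ?f = - s"
    using ford_parallelogram[of ?d a b c f g0] by (simp add: s_def f g0)
  ultimately obtain g where g: "g = g0 \<or> g = - g0"
    and sg: "fst (ford ?d a b c (f + g)) - fst ?d - fst ?e - fst ?f = 2 * (u \<bullet> v)"
    unfolding s_def by fastforce
  have d: "(idet f g)\<^sup>2 = 1" and fg: "?f = ford ?d a b c g"
    using g d0 g0 by (auto simp: idet_add ford_uminus)
  define G where "G = ford ?d a b c (f + g)"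
  have qG: "quad ?d ?e ?f G" using quad_ford[OF q d] f fg by (simp add: G_def)
  have rebase: "ford ?d ?e ?f G (m, n) = ford ?d a b c (icomb m f n g)" for m n
    using ford_rebase[of ?d a b c f g m n] f fg by (simp add: G_def)
  have "vec_of ` corona \<A> D = ford ?d ?e ?f G ` {f. coprime (fst f) (snd f)}"
  proof (intro equalityI subsetI)
    fix x assume "x \<in> vec_of ` corona \<A> D"
    then obtain X where X: "X \<in> \<A>" "vtangent ?d (vec_of X)" "x = vec_of X"
      by (auto simp: corona_def tangent_iff)
    then obtain h where h: "coprime (fst h) (snd h)" "x = ford ?d a b c h" using ex by blast
    obtain m n where "h = icomb m f n g" "coprime m n" by (rule unimodular_solve[OF d h(1)])
    then have "x = ford ?d ?e ?f G (m, n)" "(m, n) \<in> {f. coprime (fst f) (snd f)}"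
      using h(2) rebase by auto
    then show "x \<in> ford ?d ?e ?f G ` {f. coprime (fst f) (snd f)}" by blast
  next
    fix x assume "x \<in> ford ?d ?e ?f G ` {f. coprime (fst f) (snd f)}"
    then obtain h where h: "coprime (fst h) (snd h)" "x = ford ?d ?e ?f G h" by blast
    have "x \<in> vec_of ` \<A>" unfolding h(2)
      by (rule adjoin_closed_ford[OF _ qG _ _ _ h(1)]) (use packing_adjoin_closed[OF mt] A in_A in auto)
    then obtain X where X: "X \<in> \<A>" "x = vec_of X" by blast
    have "h \<noteq> 0" using h(1) by auto
    then have "vtangent ?d x" unfolding h(2) by (rule vtangent_ford[OF qG])
    then have "tangent D X"
      using X packing_is_disk[OF mt] in_A A by (simp add: tangent_iff)
    then show "x \<in> vec_of ` corona \<A> D" using X by (auto simp: corona_def)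
  qed
  then show ?thesis using that qG sg by (simp add: G_def)
qed

section \<open>Summation over coprime pairs\<close>

lemma infsum_cmult_ennreal:
  fixes h :: "'a \<Rightarrow> ennreal"
  assumes "c < top"
  shows "(\<Sum>\<^sub>\<infinity>x\<in>S. c * h x) = c * (\<Sum>\<^sub>\<infinity>x\<in>S. h x)"
proof -
  have "isCont ((*) c) (infsum h S)"
    unfolding isCont_def by (rule ennreal_tendsto_cmult[OF assms]) (rule tendsto_ident_at)
  then have "infsum ((*) c \<circ> h) S = c * infsum h S"
    by (intro infsum_comm_additive_general nonneg_summable_on_complete) (simp_all add: sum_distrib_left)
  then show ?thesis by (simp add: o_def)
qed

definition prim :: "(int \<times> int) set" where "prim = {(m, n). gcd m n = 1}"

text \<open>One representative of each pair \<open>f\<close>, \<open>- f\<close>; for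
  \<open>n = 0\<close> only (1,0) remains.\<close>

definition half_prim :: "(int \<times> int) set" where
  "half_prim = {(m, n). gcd m n = 1 \<and> (n > 0 \<or> n = 0 \<and> m > 0)}"

text \<open>\<open>prim\<close> is the disjoint union of \<open>half_prim\<close> and its negative.
  This is the source of the factor 1/2 in the area formula.\<close>

lemma infsum_prim_even:
  fixes h :: "int \<times> int \<Rightarrow> ennreal"
  assumes "\<And>f. h (- f) = h f"
  shows "infsum h prim = 2 * infsum h half_prim"
proof -
  have eq: "prim = half_prim \<union> uminus ` half_prim"
  proof (intro equalityI subsetI)
    fix f assume f: "f \<in> prim"
    show "f \<in> half_prim \<union> uminus ` half_prim"
    proof (cases "f \<in> half_prim")
      case False
      then have "- f \<in> half_prim" using f by (cases f) (auto simp: prim_def half_prim_def)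
      then show ?thesis by (metis UnI2 image_eqI minus_minus)
    qed simp
  qed (auto simp: prim_def half_prim_def)
  have "half_prim \<inter> uminus ` half_prim = {}" by (auto simp: half_prim_def)
  then have "infsum h prim = infsum h half_prim + infsum h (uminus ` half_prim)"
    unfolding eq by (intro infsum_Un_disjoint nonneg_summable_on_complete) simp_all
  also have "infsum h (uminus ` half_prim) = infsum h half_prim"
    by (subst infsum_reindex) (simp_all add: o_def assms)
  finally show ?thesis by (simp add: mult_2)
qed

text \<open>Equal unit vectors have product 1, so the determinant is 0; proportional coprime pairs
  agree up to sign, and \<open>half_prim\<close> fixes the sign.\<close>

lemma ford_inj_on_half_prim:
  assumes q: "quad D E F G"
  shows "inj_on (ford D E F G) half_prim"
proof (rule inj_onI)
  fix f g assume f: "f \<in> half_prim" and g: "g \<in> half_prim" and eq: "ford D E F G f = ford D E F G g"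
  have "disk_form (ford D E F G f) (ford D E F G g) = 1"
    unfolding eq by (simp add: disk_form_ford[OF q] idet_add)
  then have "idet f g = 0" by (simp add: disk_form_ford[OF q])
  then have 0: "fst f * snd g = fst g * snd f" by (simp add: idet_def algebra_simps)
  have cop: "coprime (fst f) (snd f)" "coprime (fst g) (snd g)"
    using f g by (auto simp: half_prim_def coprime_iff_gcd_eq_1)
  have "\<bar>fst f\<bar> = \<bar>fst g\<bar> \<and> \<bar>snd f\<bar> = \<bar>snd g\<bar>"
    using coprime_crossproduct_int[of "fst f" "snd f" "fst g" "snd g"] cop 0
    by (metis abs_mult)
  then show "f = g" using f g 0
    by (cases f; cases g) (auto simp: half_prim_def abs_if split: if_splits)
qed

lemma image_coprime_eq_half_prim:
  assumes "\<And>f. h (- f) = h f"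
  shows "h ` {f. coprime (fst f) (snd f)} = h ` half_prim"
proof (intro equalityI subsetI)
  fix x assume "x \<in> h ` {f. coprime (fst f) (snd f)}"
  then obtain f where f: "coprime (fst f) (snd f)" "x = h f" by blast
  then have "f \<in> half_prim \<or> - f \<in> half_prim"
    by (cases f) (auto simp: half_prim_def coprime_iff_gcd_eq_1)
  then show "x \<in> h ` half_prim" using f assms by (metis image_eqI)
next
  have "half_prim \<subseteq> {f. coprime (fst f) (snd f)}" by (auto simp: half_prim_def coprime_iff_gcd_eq_1)
  then show "x \<in> h ` {f. coprime (fst f) (snd f)}" if "x \<in> h ` half_prim" for x using that by blast
qed

theorem theorem3p1:
  fixes \<A> :: "gdisk set" and D E F :: gdisk and a b c d B :: real and M :: "real^2^2"
  assumes "apollonian_packing \<A>"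
    and "D \<in> \<A>" and "B = curvature D"
    and "E \<in> corona \<A> D" and "F \<in> corona \<A> D" and "tangent E F"
    and "tangency_spinor D E (Complex a b)"
    and "tangency_spinor D F (Complex c d)"
    and "M = vector [vector [a, c], vector [b, d]]"
  shows "corona_area \<A> D =
           ennreal (pi / 2) * (\<Sum>\<^sub>\<infinity>f\<in>ZE. 1 / ennreal (((norm (M *v f))\<^sup>2 - B)\<^sup>2))
       \<and> corona_area \<A> D =
           ennreal (pi / 2) * (\<Sum>\<^sub>\<infinity>(m, n)\<in>{(m :: int, n :: int). gcd m n = 1}.
             1 / ennreal (((a * of_int m + c * of_int n)\<^sup>2 + (b * of_int m + d * of_int n)\<^sup>2 - B)\<^sup>2))"
proof -
  obtain G where q: "quad (vec_of D) (vec_of E) (vec_of F) G"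
    and s: "fst G - fst (vec_of D) - fst (vec_of E) - fst (vec_of F) = 2 * (Complex a b \<bullet> Complex c d)"
    and cor: "vec_of ` corona \<A> D = ford (vec_of D) (vec_of E) (vec_of F) G ` {f. coprime (fst f) (snd f)}"
    by (rule corona_ford[OF assms(1,2,4-8)])
  let ?X = "ford (vec_of D) (vec_of E) (vec_of F) G"
  \<comment> \<open>Half-planes have \<open>fst x = 0\<close> and contribute infinity, so all sums
    are taken in \<open>ennreal\<close>.\<close>
  define A where "A x = 1 / ennreal ((fst x)\<^sup>2)" for x :: disk_vec
  have curv: "fst (?X (m, n)) = (a * of_int m + c * of_int n)\<^sup>2 + (b * of_int m + d * of_int n)\<^sup>2 - B" for m n
  proof -
    have "fst (?X (m, n)) = (norm (real_of_int m *\<^sub>R Complex a b + real_of_int n *\<^sub>R Complex c d))\<^sup>2 - B"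
      using fst_ford_spinor[OF _ _ _ spinor_vec_of[OF assms(7)] spinor_vec_of[OF assms(8)] s, of "(m, n)"] q
      by (simp add: quad_def fst_vec_of assms(3))
    then show ?thesis by (simp add: cmod_power2 mult.commute)
  qed
  have area: "disk_area X = ennreal pi * A (vec_of X)" for X
    by (simp add: disk_area_def A_def fst_vec_of ennreal_times_divide)
  have inj: "inj_on vec_of (corona \<A> D)"
    by (rule inj_onI) (auto simp: corona_def tangent_def intro: vec_of_inject)
  have "corona_area \<A> D = ennreal pi * (\<Sum>\<^sub>\<infinity>X\<in>corona \<A> D. A (vec_of X))"
    unfolding corona_area_def area by (rule infsum_cmult_ennreal) simp
  also have "(\<Sum>\<^sub>\<infinity>X\<in>corona \<A> D. A (vec_of X)) = infsum A (vec_of ` corona \<A> D)"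
    by (simp add: infsum_reindex[OF inj] o_def)
  also have "\<dots> = infsum A (?X ` half_prim)"
    unfolding cor by (subst image_coprime_eq_half_prim) (simp_all add: ford_uminus)
  also have "\<dots> = (\<Sum>\<^sub>\<infinity>f\<in>half_prim. A (?X f))"
    by (simp add: infsum_reindex[OF ford_inj_on_half_prim[OF q]] o_def)
  also have "ennreal pi = ennreal (pi / 2) * 2"
    by (simp flip: ennreal_mult' ennreal_numeral)
  also have "ennreal (pi / 2) * 2 * (\<Sum>\<^sub>\<infinity>f\<in>half_prim. A (?X f)) = ennreal (pi / 2) * (\<Sum>\<^sub>\<infinity>f\<in>prim. A (?X f))"
    by (subst infsum_prim_even) (simp_all add: ford_uminus mult.assoc)
  finally have main: "corona_area \<A> D = ennreal (pi / 2) * (\<Sum>\<^sub>\<infinity>f\<in>prim. A (?X f))" .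
  have second: "(\<Sum>\<^sub>\<infinity>f\<in>prim. A (?X f)) = (\<Sum>\<^sub>\<infinity>(m, n)\<in>{(m :: int, n :: int). gcd m n = 1}.
      1 / ennreal (((a * of_int m + c * of_int n)\<^sup>2 + (b * of_int m + d * of_int n)\<^sup>2 - B)\<^sup>2))"
    unfolding prim_def A_def by (intro infsum_cong) (auto simp: curv)
  define V :: "int \<times> int \<Rightarrow> real^2" where "V f = vector [of_int (fst f), of_int (snd f)]" for f
  have V_inj: "inj_on V prim"
    by (rule inj_onI) (auto simp: V_def vec_eq_iff forall_2 prod_eq_iff)
  have ZE: "ZE = V ` prim"
    unfolding ZE_def V_def prim_def by force
  have "(norm (M *v V (m, n)))\<^sup>2 - B = fst (?X (m, n))" for m n
    unfolding curv power2_norm_eq_inner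
    by (simp add: V_def assms(9) inner_vec_def sum_2 matrix_vector_mult_def power2_eq_square)
  then have "1 / ennreal (((norm (M *v V f))\<^sup>2 - B)\<^sup>2) = A (?X f)" for f
    unfolding A_def by (metis surj_pair)
  then have first: "(\<Sum>\<^sub>\<infinity>f\<in>ZE. 1 / ennreal (((norm (M *v f))\<^sup>2 - B)\<^sup>2)) = (\<Sum>\<^sub>\<infinity>f\<in>prim. A (?X f))"
    unfolding ZE infsum_reindex[OF V_inj] by (simp add: o_def)
  show ?thesis using main unfolding first second[symmetric] by simp
qed

end
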